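(* Let $(\mathfrak g,[-,-,-]^1_{\mathfrak g},[-,-,-]^2_{\mathfrak g},\alpha_{\mathfrak g})$ be a compatible Hom-Lie triple system and $(V,[-,-,-]^1_V,[-,-,-]^2_V,\alpha_V)$ a Hom-vector space regarded as a compatible Hom-Lie triple system with both brackets trivial. Then abelian extensions of $\mathfrak g$ by $V$ are classified by the second cohomology group of $\mathfrak g$ with coefficients in the induced representation $(V,\theta^1_V,\theta^2_V,\alpha_V)$; that is, for a representation $(V,\theta^1_V,\theta^2_V,\alpha_V)$ of $\mathfrak g$, the equivalence classes of abelian extensions of $\mathfrak g$ by $V$ inducing this representation are in one-to-one correspondence with $\mathcal H^2_{\mathrm{cHLts}}(\mathfrak g,V)$.
   Context: All vector spaces and (multi)linear maps are over a field $\mathbb K$ of characteristic zero. Write $\alpha=\alpha_{\mathfrak g}$, $\beta=\alpha_V$. A Hom-vector space is a vector space with a linear endomorphism. A Hom-Lie triple system $(\mathfrak g,[-,-,-],\alpha)$ is a vector space $\mathfrak g$ with a trilinear operation and a linear map $\alpha$ such that $\alpha([x,y,z])=[\alpha(x),\alpha(y),\alpha(z)]$, $[x,y,z]+[y,x,z]=0$, $[x,y,z]+[z,x,y]+[y,z,x]=0$, and $[\alpha(a),\alpha(b),[x,y,z]]=[[a,b,x],\alpha(y),\alpha(z)]+[\alpha(x),[a,b,y],\alpha(z)]+[\alpha(x),\alpha(y),[a,b,z]]$ for all $a,b,x,y,z\in\mathfrak g$. A compatible Hom-Lie triple system $(\mathfrak g,[-,-,-]^1,[-,-,-]^2,\alpha)$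 consists of two Hom-Lie triple systems $(\mathfrak g,[-,-,-]^1,\alpha)$, $(\mathfrak g,[-,-,-]^2,\alpha)$ such that for all $a,b,x,y,z$: $[\alpha(a),\alpha(b),[x,y,z]^2]^1+[\alpha(a),\alpha(b),[x,y,z]^1]^2=[[a,b,x]^1,\alpha(y),\alpha(z)]^2+[[a,b,x]^2,\alpha(y),\alpha(z)]^1+[\alpha(x),[a,b,y]^1,\alpha(z)]^2+[\alpha(x),[a,b,y]^2,\alpha(z)]^1+[\alpha(x),\alpha(y),[a,b,z]^1]^2+[\alpha(x),\alpha(y),[a,b,z]^2]^1.$ A homomorphism of compatible Hom-Lie triple systems is a linear map commuting with the structure maps $\alpha$ and preserving both brackets; an isomorphism is a bijective homomorphism. A representation $(V,\theta,\beta)$ of a Hom-Lie triple system $(\mathfrak g,[-,-,-],\alpha)$ is a Hom-vector space $(V,\beta)$ with a bilinear map $\theta:\mathfrak g\times\mathfrak g\to\mathrm{End}(V)$ such that, with $D(x,y)=\theta(y,x)-\theta(x,y)$, for all $x,y,a,b\in\mathfrak g$: $\theta(\alpha(x),\alpha(y))\circ\beta=\beta\circ\theta(x,y)$; $\theta(\alpha(a),\alpha(b))\theta(x,y)-\theta(\alpha(y),\alpha(b))\theta(x,a)-\theta(\alpha(x),[y,a,b])\circ\beta+D(\alpha(y),\alpha(a))\theta(x,b)=0$; $\theta(\alpha(a),\alpha(b))D(x,y)-D(\alpha(x),\alpha(y))\theta(a,b)+\theta([x,y,a],\alpha(b))\circ\beta+\theta(\alpha(a),[x,y,b])\circ\beta=0$.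 A representation $(V,\theta_1,\theta_2,\beta)$ of a compatible Hom-Lie triple system is such that $(V,\theta_i,\beta)$ is a representation of $(\mathfrak g,[-,-,-]^i,\alpha)$ for $i=1,2$ and, with $D_k(x,y)=\theta_k(y,x)-\theta_k(x,y)$, for all $a_1,a_2,a_3,a_4\in\mathfrak g$: (1) $\theta_1(\alpha(a_1),[a_2,a_3,a_4]^2)\circ\beta+\theta_2(\alpha(a_1),[a_2,a_3,a_4]^1)\circ\beta+\theta_1(\alpha(a_2),\alpha(a_4))\theta_2(a_1,a_3)+\theta_2(\alpha(a_2),\alpha(a_4))\theta_1(a_1,a_3)-\theta_1(\alpha(a_3),\alpha(a_4))\theta_2(a_1,a_2)-\theta_2(\alpha(a_3),\alpha(a_4))\theta_1(a_1,a_2)-D_1(\alpha(a_2),\alpha(a_3))\theta_2(a_1,a_4)-D_2(\alpha(a_2),\alpha(a_3))\theta_1(a_1,a_4)=0$; (2) $D_1(\alpha(a_3),[a_1,a_2,a_4]^2)\circ\beta+D_2(\alpha(a_3),[a_1,a_2,a_4]^1)\circ\beta+D_1([a_1,a_2,a_3]^2,\alpha(a_4))\circ\beta+D_2([a_1,a_2,a_3]^1,\alpha(a_4))\circ\beta-D_1(\alpha(a_1),\alpha(a_2))D_2(a_3,a_4)+D_2(\alpha(a_3),\alpha(a_4))D_1(a_1,a_2)+D_1(\alpha(a_3),\alpha(a_4))D_2(a_1,a_2)-D_2(\alpha(a_1),\alpha(a_2))D_1(a_3,a_4)=0$. Cohomology: $\mathcal C^1_{\mathrm{HLts}}(\mathfrak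 g,V)$ is the space of linear $f:\mathfrak g\to V$ with $\beta\circ f=f\circ\alpha$. For $n\ge1$, $\mathcal C^{n+1}_{\mathrm{HLts}}(\mathfrak g,V)$ is the space of linear $f:(\wedge^2\mathfrak g)^{\otimes n}\otimes\mathfrak g\to V$ with $\beta\circ f=f\circ((\alpha^{\wedge2})^{\otimes n}\otimes\alpha)$ and such that the sum over cyclic permutations of $(a,b,c)$ of $f(\mathfrak A_1,\dots,\mathfrak A_{n-1},a\wedge b,c)$ is $0$. For a Hom-Lie triple system with representation $(V,\theta,\beta)$, $\delta:\mathcal C^n_{\mathrm{HLts}}\to\mathcal C^{n+1}_{\mathrm{HLts}}$ is, with $\mathfrak A_i=a_i\wedge b_i$, $\alpha(\mathfrak A_i)=\alpha(a_i)\wedge\alpha(b_i)$, a hat denoting omission, $$\begin{aligned}\delta f(\mathfrak A_1,\dots,\mathfrak A_n,c)=&\ \theta(\alpha^{n-1}(b_n),\alpha^{n-1}(c))f(\mathfrak A_1,\dots,\mathfrak A_{n-1},a_n)-\theta(\alpha^{n-1}(a_n),\alpha^{n-1}(c))f(\mathfrak A_1,\dots,\mathfrak A_{n-1},b_n)\\&+\sum_{i=1}^n(-1)^{i+n}D(\alpha^{n-1}(a_i),\alpha^{n-1}(b_i))f(\mathfrak A_1,\dots,\widehat{\mathfrak A_i},\dots,\mathfrak A_n,c)\\&+\sum_{i=1}^n\sum_{j=i+1}^n(-1)^{i+n+1}f(\alpha(\mathfrak A_1),\dots,\widehat{\mathfrak A_i},\dots,[a_i,b_i,a_j]\wedge\alpha(b_j)+\alpha(a_j)\wedge[a_i,b_i,b_j],\dots,\alpha(\mathfrak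 A_n),\alpha(c))\\&+\sum_{i=1}^n(-1)^{i+n+1}f(\alpha(\mathfrak A_1),\dots,\widehat{\mathfrak A_i},\dots,\alpha(\mathfrak A_n),[a_i,b_i,c]).\end{aligned}$$ Given a representation $(V,\theta_1,\theta_2,\beta)$ of the compatible system, $\delta_i$ denotes this operator for $(\mathfrak g,[-,-,-]^i,\alpha)$ and $(V,\theta_i,\beta)$. $\mathcal C^n_{\mathrm{cHLts}}(\mathfrak g,V)$ is the direct sum of $n$ copies of $\mathcal C^n_{\mathrm{HLts}}(\mathfrak g,V)$, with $\delta_cf=(\delta_1f,\delta_2f)$ for $n=1$ and $\delta_c(f_1,\dots,f_n)=(\delta_1f_1,\delta_1f_2+\delta_2f_1,\dots,\delta_1f_n+\delta_2f_{n-1},\delta_2f_n)$ for $n\ge2$. $\mathcal H^2_{\mathrm{cHLts}}(\mathfrak g,V)=\ker(\delta_c|_{\mathcal C^2_{\mathrm{cHLts}}})/\delta_c(\mathcal C^1_{\mathrm{cHLts}})$. Abelian extensions: an abelian extension of $\mathfrak g$ by $V$ is a short exact sequence $0\to V\xrightarrow{i}\hat{\mathfrak g}\xrightarrow{p}\mathfrak g\to0$ of homomorphisms of compatible Hom-Lie triple systems, where $(\hat{\mathfrak g},[-,-,-]^1_{\hat{\mathfrak g}},[-,-,-]^2_{\hat{\mathfrak g}},\alpha_{\hat{\mathfrak g}})$ is a compatible Hom-Lie triple system, such that $[u,v,-]^1_{\hat{\mathfrak g}}=[u,v,-]^2_{\hat{\mathfrak g}}=0$ for all $u,v\in V$, i.e.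 $V$ is an abelian ideal of $\hat{\mathfrak g}$. A section is a linear map $\sigma:\mathfrak g\to\hat{\mathfrak g}$ with $p\circ\sigma=\mathrm{id}_{\mathfrak g}$. The induced representation on $(V,\alpha_V)$ is $\theta^i_V(a,b)(u)=[u,\sigma(a),\sigma(b)]^i_{\hat{\mathfrak g}}$ for $i=1,2$ (independent of the choice of $\sigma$), and the associated 2-cocycle is $(\mu_1,\mu_2)$ with $\mu_i(a,b,c)=[\sigma(a),\sigma(b),\sigma(c)]^i_{\hat{\mathfrak g}}-\sigma([a,b,c]^i_{\mathfrak g})$; the correspondence sends an extension to the class of $(\mu_1,\mu_2)$. Two abelian extensions $(\hat{\mathfrak g}_1,i_1,p_1)$ and $(\hat{\mathfrak g}_2,i_2,p_2)$ are equivalent if there is an isomorphism of compatible Hom-Lie triple systems $\zeta:\hat{\mathfrak g}_1\to\hat{\mathfrak g}_2$ with $\zeta\circ i_1=i_2$ and $p_2\circ\zeta=p_1$.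
   Formalization: Only extensions having a section that commutes with the twists are classified (others break the claim); the correspondence is asserted when some such extension induces the representation, which is shown equivalent to an extra mixed identity not implied by conditions (1),(2). *)

theory Defs
  imports "HOL-Algebra.Algebraic_Closure_Type" "HOL-Library.Function_Algebras"
begin

section \<open>Compatible Hom-Lie triple systems\<close>

text \<open>
  Vector spaces that have to be quantified over (the total spaces of extensions) are modules in the
  sense of HOL-Algebra over the field given by the type \<open>'k\<close>. The fixed spaces \<open>\<gg>\<close> and \<open>V\<close> are
  types with a scalar multiplication satisfying \<^const>\<open>vector_space\<close>; they enter the definitions of
  this section through \<open>chlts_of\<close> below.
\<close>

definition vs_hom ::
  "('k, 'a, 'm) module_scheme \<Rightarrow> ('k, 'b, 'n) module_scheme \<Rightarrow> ('a \<Rightarrow> 'b) \<Rightarrow> bool" where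
  "vs_hom M N f \<longleftrightarrow>
     f \<in> carrier M \<rightarrow> carrier N \<and>
     (\<forall>x\<in>carrier M. \<forall>y\<in>carrier M. f (x \<oplus>\<^bsub>M\<^esub> y) = f x \<oplus>\<^bsub>N\<^esub> f y) \<and>
     (\<forall>k. \<forall>x\<in>carrier M. f (k \<odot>\<^bsub>M\<^esub> x) = k \<odot>\<^bsub>N\<^esub> f x)"

definition trilinear :: "('k, 'a, 'm) module_scheme \<Rightarrow> ('a \<Rightarrow> 'a \<Rightarrow> 'a \<Rightarrow> 'a) \<Rightarrow> bool" where
  "trilinear M br \<longleftrightarrow>
     (\<forall>x\<in>carrier M. \<forall>y\<in>carrier M.
        vs_hom M M (\<lambda>z. br z x y) \<and> vs_hom M M (\<lambda>z. br x z y) \<and> vs_hom M M (\<lambda>z. br x y z))"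

definition hom_lts ::
  "('k::field, 'a, 'm) module_scheme \<Rightarrow> ('a \<Rightarrow> 'a \<Rightarrow> 'a \<Rightarrow> 'a) \<Rightarrow> ('a \<Rightarrow> 'a) \<Rightarrow> bool" where
  "hom_lts M br \<alpha> \<longleftrightarrow>
     Module.module (ring_of_type_algebra :: 'k ring) M \<and> trilinear M br \<and> vs_hom M M \<alpha> \<and>
     (\<forall>x\<in>carrier M. \<forall>y\<in>carrier M. \<forall>z\<in>carrier M.
        \<alpha> (br x y z) = br (\<alpha> x) (\<alpha> y) (\<alpha> z) \<and>
        br x y z \<oplus>\<^bsub>M\<^esub> br y x z = \<zero>\<^bsub>M\<^esub> \<and>
        br x y z \<oplus>\<^bsub>M\<^esub> br z x y \<oplus>\<^bsub>M\<^esub> br y z x = \<zero>\<^bsub>M\<^esub>) \<and>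
     (\<forall>a\<in>carrier M. \<forall>b\<in>carrier M. \<forall>x\<in>carrier M. \<forall>y\<in>carrier M. \<forall>z\<in>carrier M.
        br (\<alpha> a) (\<alpha> b) (br x y z) =
        br (br a b x) (\<alpha> y) (\<alpha> z) \<oplus>\<^bsub>M\<^esub> br (\<alpha> x) (br a b y) (\<alpha> z) \<oplus>\<^bsub>M\<^esub> br (\<alpha> x) (\<alpha> y) (br a b z))"

record ('k, 'a) chlts = "('k, 'a) module" +
  bracket1 :: "'a \<Rightarrow> 'a \<Rightarrow> 'a \<Rightarrow> 'a"
  bracket2 :: "'a \<Rightarrow> 'a \<Rightarrow> 'a \<Rightarrow> 'a"
  twist :: "'a \<Rightarrow> 'a"

definition compatible_hom_lts :: "('k::field, 'a) chlts \<Rightarrow> bool" where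
  "compatible_hom_lts L \<longleftrightarrow>
     (let b1 = bracket1 L; b2 = bracket2 L; \<alpha> = twist L in
      hom_lts L b1 \<alpha> \<and> hom_lts L b2 \<alpha> \<and>
      (\<forall>a\<in>carrier L. \<forall>b\<in>carrier L. \<forall>x\<in>carrier L. \<forall>y\<in>carrier L. \<forall>z\<in>carrier L.
         b1 (\<alpha> a) (\<alpha> b) (b2 x y z) \<oplus>\<^bsub>L\<^esub> b2 (\<alpha> a) (\<alpha> b) (b1 x y z) =
         b2 (b1 a b x) (\<alpha> y) (\<alpha> z) \<oplus>\<^bsub>L\<^esub> b1 (b2 a b x) (\<alpha> y) (\<alpha> z)
         \<oplus>\<^bsub>L\<^esub> b2 (\<alpha> x) (b1 a b y) (\<alpha> z) \<oplus>\<^bsub>L\<^esub> b1 (\<alpha> x) (b2 a b y) (\<alpha> z)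
         \<oplus>\<^bsub>L\<^esub> b2 (\<alpha> x) (\<alpha> y) (b1 a b z) \<oplus>\<^bsub>L\<^esub> b1 (\<alpha> x) (\<alpha> y) (b2 a b z)))"

definition chlts_hom :: "('k, 'a) chlts \<Rightarrow> ('k, 'b) chlts \<Rightarrow> ('a \<Rightarrow> 'b) \<Rightarrow> bool" where
  "chlts_hom L M f \<longleftrightarrow>
     vs_hom L M f \<and>
     (\<forall>x\<in>carrier L. f (twist L x) = twist M (f x)) \<and>
     (\<forall>x\<in>carrier L. \<forall>y\<in>carrier L. \<forall>z\<in>carrier L.
        f (bracket1 L x y z) = bracket1 M (f x) (f y) (f z) \<and>
        f (bracket2 L x y z) = bracket2 M (f x) (f y) (f z))"

definition chlts_iso :: "('k, 'a) chlts \<Rightarrow> ('k, 'b) chlts \<Rightarrow> ('a \<Rightarrow> 'b) \<Rightarrow> bool" where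
  "chlts_iso L M f \<longleftrightarrow> chlts_hom L M f \<and> bij_betw f (carrier L) (carrier M)"

text \<open>
  The structure with underlying vector space the whole type. The fields \<^const>\<open>monoid.mult\<close> and
  \<^const>\<open>monoid.one\<close>, inherited by \<^typ>\<open>('k, 'a) module\<close>, are never used.
\<close>

definition chlts_of ::
  "('k \<Rightarrow> 'a::ab_group_add \<Rightarrow> 'a) \<Rightarrow> ('a \<Rightarrow> 'a \<Rightarrow> 'a \<Rightarrow> 'a) \<Rightarrow> ('a \<Rightarrow> 'a \<Rightarrow> 'a \<Rightarrow> 'a) \<Rightarrow> ('a \<Rightarrow> 'a)
    \<Rightarrow> ('k, 'a) chlts" where
  "chlts_of s b1 b2 \<alpha> =
     \<lparr>carrier = UNIV, monoid.mult = (\<lambda>_ _. 0), one = 0, zero = 0, add = (+), module.smult = s,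
      bracket1 = b1, bracket2 = b2, twist = \<alpha>\<rparr>"

definition hom_vector_space :: "('k::field \<Rightarrow> 'v::ab_group_add \<Rightarrow> 'v) \<Rightarrow> ('v \<Rightarrow> 'v) \<Rightarrow> bool" where
  "hom_vector_space s \<beta> \<longleftrightarrow> vector_space s \<and> Vector_Spaces.linear s s \<beta>"

abbreviation trivial_chlts ::
  "('k \<Rightarrow> 'v::ab_group_add \<Rightarrow> 'v) \<Rightarrow> ('v \<Rightarrow> 'v) \<Rightarrow> ('k, 'v) chlts" where
  "trivial_chlts s \<beta> \<equiv> chlts_of s (\<lambda>_ _ _. 0) (\<lambda>_ _ _. 0) \<beta>"


section \<open>Representations\<close>

definition rep_D :: "('g \<Rightarrow> 'g \<Rightarrow> 'v \<Rightarrow> 'v::ab_group_add) \<Rightarrow> 'g \<Rightarrow> 'g \<Rightarrow> 'v \<Rightarrow> 'v" where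
  "rep_D \<theta> x y u = \<theta> y x u - \<theta> x y u"

definition hom_lts_rep ::
  "('k::field \<Rightarrow> 'g::ab_group_add \<Rightarrow> 'g) \<Rightarrow> ('g \<Rightarrow> 'g \<Rightarrow> 'g \<Rightarrow> 'g) \<Rightarrow> ('g \<Rightarrow> 'g)
    \<Rightarrow> ('k \<Rightarrow> 'v::ab_group_add \<Rightarrow> 'v) \<Rightarrow> ('v \<Rightarrow> 'v) \<Rightarrow> ('g \<Rightarrow> 'g \<Rightarrow> 'v \<Rightarrow> 'v) \<Rightarrow> bool" where
  "hom_lts_rep sg br \<alpha> sv \<beta> \<theta> \<longleftrightarrow>
     hom_vector_space sv \<beta> \<and>
     (\<forall>x y. Vector_Spaces.linear sv sv (\<theta> x y)) \<and>
     (\<forall>x u. Vector_Spaces.linear sg sv (\<lambda>y. \<theta> x y u)) \<and>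
     (\<forall>y u. Vector_Spaces.linear sg sv (\<lambda>x. \<theta> x y u)) \<and>
     (\<forall>x y u. \<theta> (\<alpha> x) (\<alpha> y) (\<beta> u) = \<beta> (\<theta> x y u)) \<and>
     (\<forall>x y a b u.
        \<theta> (\<alpha> a) (\<alpha> b) (\<theta> x y u) - \<theta> (\<alpha> y) (\<alpha> b) (\<theta> x a u)
        - \<theta> (\<alpha> x) (br y a b) (\<beta> u) + rep_D \<theta> (\<alpha> y) (\<alpha> a) (\<theta> x b u) = 0) \<and>
     (\<forall>x y a b u.
        \<theta> (\<alpha> a) (\<alpha> b) (rep_D \<theta> x y u) - rep_D \<theta> (\<alpha> x) (\<alpha> y) (\<theta> a b u)
        + \<theta> (br x y a) (\<alpha> b) (\<beta> u) + \<theta> (\<alpha> a) (br x y b) (\<beta> u) = 0)"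

definition compatible_rep ::
  "('k::field \<Rightarrow> 'g::ab_group_add \<Rightarrow> 'g) \<Rightarrow> ('g \<Rightarrow> 'g \<Rightarrow> 'g \<Rightarrow> 'g) \<Rightarrow> ('g \<Rightarrow> 'g \<Rightarrow> 'g \<Rightarrow> 'g) \<Rightarrow> ('g \<Rightarrow> 'g)
    \<Rightarrow> ('k \<Rightarrow> 'v::ab_group_add \<Rightarrow> 'v) \<Rightarrow> ('v \<Rightarrow> 'v)
    \<Rightarrow> ('g \<Rightarrow> 'g \<Rightarrow> 'v \<Rightarrow> 'v) \<Rightarrow> ('g \<Rightarrow> 'g \<Rightarrow> 'v \<Rightarrow> 'v) \<Rightarrow> bool" where
  "compatible_rep sg b1 b2 \<alpha> sv \<beta> \<theta>1 \<theta>2 \<longleftrightarrow>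
     hom_lts_rep sg b1 \<alpha> sv \<beta> \<theta>1 \<and> hom_lts_rep sg b2 \<alpha> sv \<beta> \<theta>2 \<and>
     (\<forall>a1 a2 a3 a4 u.
        \<theta>1 (\<alpha> a1) (b2 a2 a3 a4) (\<beta> u) + \<theta>2 (\<alpha> a1) (b1 a2 a3 a4) (\<beta> u)
        + \<theta>1 (\<alpha> a2) (\<alpha> a4) (\<theta>2 a1 a3 u) + \<theta>2 (\<alpha> a2) (\<alpha> a4) (\<theta>1 a1 a3 u)
        - \<theta>1 (\<alpha> a3) (\<alpha> a4) (\<theta>2 a1 a2 u) - \<theta>2 (\<alpha> a3) (\<alpha> a4) (\<theta>1 a1 a2 u)
        - rep_D \<theta>1 (\<alpha> a2) (\<alpha> a3) (\<theta>2 a1 a4 u) - rep_D \<theta>2 (\<alpha> a2) (\<alpha> a3) (\<theta>1 a1 a4 u) = 0) \<and>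
     (\<forall>a1 a2 a3 a4 u.
        rep_D \<theta>1 (\<alpha> a3) (b2 a1 a2 a4) (\<beta> u) + rep_D \<theta>2 (\<alpha> a3) (b1 a1 a2 a4) (\<beta> u)
        + rep_D \<theta>1 (b2 a1 a2 a3) (\<alpha> a4) (\<beta> u) + rep_D \<theta>2 (b1 a1 a2 a3) (\<alpha> a4) (\<beta> u)
        - rep_D \<theta>1 (\<alpha> a1) (\<alpha> a2) (rep_D \<theta>2 a3 a4 u) + rep_D \<theta>2 (\<alpha> a3) (\<alpha> a4) (rep_D \<theta>1 a1 a2 u)
        + rep_D \<theta>1 (\<alpha> a3) (\<alpha> a4) (rep_D \<theta>2 a1 a2 u)
        - rep_D \<theta>2 (\<alpha> a1) (\<alpha> a2) (rep_D \<theta>1 a3 a4 u) = 0)"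

text \<open>
  The polarisation of the last axiom of \<^const>\<open>hom_lts_rep\<close>. Both it and the last clause of
  \<^const>\<open>compatible_rep\<close> are instances of the compatibility identity in an extension with one
  argument in \<open>V\<close>. The clause in \<^const>\<open>compatible_rep\<close> is its part antisymmetric in \<open>a\<close>, \<open>b\<close>,
  and does not imply it: for \<open>\<alpha> = \<beta> = id\<close>, zero brackets, \<open>\<gg> = \<langle>e, f\<rangle>\<close>,
  \<open>V = \<langle>v\<^sub>0, w\<^sub>e, w\<^sub>f, v\<^sub>1\<rangle>\<close>, write \<open>x = x\<^sub>e e + x\<^sub>f f\<close> and \<open>w x = x\<^sub>e w\<^sub>e + x\<^sub>f w\<^sub>f\<close>; let \<open>\<theta>\<^sub>2 x y\<close> map
  \<open>v\<^sub>0\<close> to \<open>x\<^sub>e (w y)\<close>, let \<open>\<theta>\<^sub>1 x y\<close> map \<open>w z\<close> to \<open>x\<^sub>e (y\<^sub>e z\<^sub>f - y\<^sub>f z\<^sub>e) v\<^sub>1\<close>, and let both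
  vanish on the remaining basis vectors. This satisfies \<^const>\<open>compatible_rep\<close>, but the identity
  below fails at \<open>x = a = b = e\<close>, \<open>y = f\<close>, \<open>u = v\<^sub>0\<close>.
\<close>

definition mixed_rep_identity ::
  "('g \<Rightarrow> 'g \<Rightarrow> 'g \<Rightarrow> 'g) \<Rightarrow> ('g \<Rightarrow> 'g \<Rightarrow> 'g \<Rightarrow> 'g) \<Rightarrow> ('g \<Rightarrow> 'g) \<Rightarrow> ('v::ab_group_add \<Rightarrow> 'v)
    \<Rightarrow> ('g \<Rightarrow> 'g \<Rightarrow> 'v \<Rightarrow> 'v) \<Rightarrow> ('g \<Rightarrow> 'g \<Rightarrow> 'v \<Rightarrow> 'v) \<Rightarrow> bool" where
  "mixed_rep_identity b1 b2 \<alpha> \<beta> \<theta>1 \<theta>2 \<longleftrightarrow>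
     (\<forall>x y a b u.
        \<theta>1 (\<alpha> a) (\<alpha> b) (rep_D \<theta>2 x y u) + \<theta>2 (\<alpha> a) (\<alpha> b) (rep_D \<theta>1 x y u)
        - rep_D \<theta>1 (\<alpha> x) (\<alpha> y) (\<theta>2 a b u) - rep_D \<theta>2 (\<alpha> x) (\<alpha> y) (\<theta>1 a b u)
        + \<theta>1 (b2 x y a) (\<alpha> b) (\<beta> u) + \<theta>2 (b1 x y a) (\<alpha> b) (\<beta> u)
        + \<theta>1 (\<alpha> a) (b2 x y b) (\<beta> u) + \<theta>2 (\<alpha> a) (b1 x y b) (\<beta> u) = 0)"


section \<open>Cohomology\<close>

text \<open>
  An \<open>n\<close>-cochain, \<open>n \<ge> 1\<close>, takes the list of the \<open>n - 1\<close> pairs \<open>(a\<^sub>i, b\<^sub>i)\<close> standing for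
  \<open>a\<^sub>i \<and> b\<^sub>i\<close>, and the last argument. By the universal property of \<open>(\<and>\<^sup>2\<gg>)\<^sup>\<otimes> \<otimes> \<gg>\<close>, linear
  maps are multilinear maps alternating in each pair. On lists of any other length a cochain is
  \<open>0\<close>, so that it is determined by its values on the intended domain.
\<close>

type_synonym ('g, 'v) cochain = "('g \<times> 'g) list \<Rightarrow> 'g \<Rightarrow> 'v"

definition cochains ::
  "('k::field \<Rightarrow> 'g::ab_group_add \<Rightarrow> 'g) \<Rightarrow> ('g \<Rightarrow> 'g) \<Rightarrow> ('k \<Rightarrow> 'v::ab_group_add \<Rightarrow> 'v) \<Rightarrow> ('v \<Rightarrow> 'v)
    \<Rightarrow> nat \<Rightarrow> ('g, 'v) cochain set" where
  "cochains sg \<alpha> sv \<beta> n = {f.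
     (\<forall>As c. length As \<noteq> n - 1 \<longrightarrow> f As c = 0) \<and>
     (\<forall>As. length As = n - 1 \<longrightarrow> Vector_Spaces.linear sg sv (f As)) \<and>
     (\<forall>As i c. length As = n - 1 \<longrightarrow> i < n - 1 \<longrightarrow>
        (\<forall>b. Vector_Spaces.linear sg sv (\<lambda>a. f (As[i := (a, b)]) c)) \<and>
        (\<forall>a. Vector_Spaces.linear sg sv (\<lambda>b. f (As[i := (a, b)]) c)) \<and>
        (\<forall>a. f (As[i := (a, a)]) c = 0)) \<and>
     (\<forall>As c. length As = n - 1 \<longrightarrow> \<beta> (f As c) = f (map (map_prod \<alpha> \<alpha>) As) (\<alpha> c)) \<and>
     (\<forall>As a b c. 2 \<le> n \<longrightarrow> length As = n - 2 \<longrightarrow>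
        f (As @ [(a, b)]) c + f (As @ [(b, c)]) a + f (As @ [(c, a)]) b = 0)}"

text \<open>Omission of the \<open>i\<close>-th entry, counted from 1 as the indices in the coboundary formula.\<close>

definition omit :: "nat \<Rightarrow> 'a list \<Rightarrow> 'a list" where
  "omit i As = take (i - 1) As @ drop i As"

text \<open>
  The coboundary on \<open>n\<close>-cochains. The value of \<open>f\<close> at
  \<open>[a\<^sub>i, b\<^sub>i, a\<^sub>j] \<and> \<alpha> b\<^sub>j + \<alpha> a\<^sub>j \<and> [a\<^sub>i, b\<^sub>i, b\<^sub>j]\<close> is written as a sum of two values.
\<close>

definition coboundary ::
  "('g \<Rightarrow> 'g \<Rightarrow> 'g \<Rightarrow> 'g) \<Rightarrow> ('g \<Rightarrow> 'g) \<Rightarrow> ('k::field \<Rightarrow> 'v::ab_group_add \<Rightarrow> 'v) \<Rightarrow> ('g \<Rightarrow> 'g \<Rightarrow> 'v \<Rightarrow> 'v)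
    \<Rightarrow> nat \<Rightarrow> ('g, 'v) cochain \<Rightarrow> ('g, 'v) cochain" where
  "coboundary br \<alpha> sv \<theta> n f As c =
     (if length As \<noteq> n then 0 else
      (let a = (\<lambda>i. fst (As ! (i - 1))); b = (\<lambda>i. snd (As ! (i - 1)));
           \<alpha>' = \<alpha> ^^ (n - 1); \<alpha>As = map (map_prod \<alpha> \<alpha>) As
       in
         \<theta> (\<alpha>' (b n)) (\<alpha>' c) (f (omit n As) (a n)) - \<theta> (\<alpha>' (a n)) (\<alpha>' c) (f (omit n As) (b n))
         + (\<Sum>i=1..n. sv ((-1) ^ (i + n)) (rep_D \<theta> (\<alpha>' (a i)) (\<alpha>' (b i)) (f (omit i As) c)))
         + (\<Sum>i=1..n. \<Sum>j=i+1..n. sv ((-1) ^ (i + n + 1))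
              (f (omit i (\<alpha>As[j - 1 := (br (a i) (b i) (a j), \<alpha> (b j))])) (\<alpha> c)
               + f (omit i (\<alpha>As[j - 1 := (\<alpha> (a j), br (a i) (b i) (b j))])) (\<alpha> c)))
         + (\<Sum>i=1..n. sv ((-1) ^ (i + n + 1)) (f (omit i \<alpha>As) (br (a i) (b i) c)))))"

text \<open>Elements of a direct sum of copies of the space of cochains are lists of cochains.\<close>

definition cochains_c ::
  "('k::field \<Rightarrow> 'g::ab_group_add \<Rightarrow> 'g) \<Rightarrow> ('g \<Rightarrow> 'g) \<Rightarrow> ('k \<Rightarrow> 'v::ab_group_add \<Rightarrow> 'v) \<Rightarrow> ('v \<Rightarrow> 'v)
    \<Rightarrow> nat \<Rightarrow> ('g, 'v) cochain list set" where
  "cochains_c sg \<alpha> sv \<beta> n = {fs. length fs = n \<and> set fs \<subseteq> cochains sg \<alpha> sv \<beta> n}"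

text \<open>
  \<open>(f\<^sub>1, \<dots>, f\<^sub>n) \<mapsto> (\<delta>\<^sub>1 f\<^sub>1, \<delta>\<^sub>1 f\<^sub>2 + \<delta>\<^sub>2 f\<^sub>1, \<dots>, \<delta>\<^sub>1 f\<^sub>n + \<delta>\<^sub>2 f\<^sub>n\<^sub>-\<^sub>1, \<delta>\<^sub>2 f\<^sub>n)\<close>, as the
  entrywise sum of \<open>(\<delta>\<^sub>1 f\<^sub>1, \<dots>, \<delta>\<^sub>1 f\<^sub>n, 0)\<close> and \<open>(0, \<delta>\<^sub>2 f\<^sub>1, \<dots>, \<delta>\<^sub>2 f\<^sub>n)\<close>.
\<close>

definition coboundary_c ::
  "('g \<Rightarrow> 'g \<Rightarrow> 'g \<Rightarrow> 'g) \<Rightarrow> ('g \<Rightarrow> 'g \<Rightarrow> 'g \<Rightarrow> 'g) \<Rightarrow> ('g \<Rightarrow> 'g) \<Rightarrow> ('k::field \<Rightarrow> 'v::ab_group_add \<Rightarrow> 'v)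
    \<Rightarrow> ('g \<Rightarrow> 'g \<Rightarrow> 'v \<Rightarrow> 'v) \<Rightarrow> ('g \<Rightarrow> 'g \<Rightarrow> 'v \<Rightarrow> 'v)
    \<Rightarrow> nat \<Rightarrow> ('g, 'v) cochain list \<Rightarrow> ('g, 'v) cochain list" where
  "coboundary_c b1 b2 \<alpha> sv \<theta>1 \<theta>2 n fs =
     map2 (+) (map (coboundary b1 \<alpha> sv \<theta>1 n) fs @ [0]) ([0] @ map (coboundary b2 \<alpha> sv \<theta>2 n) fs)"

definition cocycles_c ::
  "('k::field \<Rightarrow> 'g::ab_group_add \<Rightarrow> 'g) \<Rightarrow> ('g \<Rightarrow> 'g \<Rightarrow> 'g \<Rightarrow> 'g) \<Rightarrow> ('g \<Rightarrow> 'g \<Rightarrow> 'g \<Rightarrow> 'g) \<Rightarrow> ('g \<Rightarrow> 'g)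
    \<Rightarrow> ('k \<Rightarrow> 'v::ab_group_add \<Rightarrow> 'v) \<Rightarrow> ('v \<Rightarrow> 'v)
    \<Rightarrow> ('g \<Rightarrow> 'g \<Rightarrow> 'v \<Rightarrow> 'v) \<Rightarrow> ('g \<Rightarrow> 'g \<Rightarrow> 'v \<Rightarrow> 'v) \<Rightarrow> nat \<Rightarrow> ('g, 'v) cochain list set" where
  "cocycles_c sg b1 b2 \<alpha> sv \<beta> \<theta>1 \<theta>2 n =
     {fs \<in> cochains_c sg \<alpha> sv \<beta> n. coboundary_c b1 b2 \<alpha> sv \<theta>1 \<theta>2 n fs = replicate (n + 1) 0}"

text \<open>
  The quotient of \<open>n\<close>-cocycles by coboundaries of \<open>(n - 1)\<close>-cochains, for \<open>n \<ge> 2\<close>, is the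
  quotient by the relation of differing by a coboundary.
\<close>

definition cohomologous ::
  "('k::field \<Rightarrow> 'g::ab_group_add \<Rightarrow> 'g) \<Rightarrow> ('g \<Rightarrow> 'g \<Rightarrow> 'g \<Rightarrow> 'g) \<Rightarrow> ('g \<Rightarrow> 'g \<Rightarrow> 'g \<Rightarrow> 'g) \<Rightarrow> ('g \<Rightarrow> 'g)
    \<Rightarrow> ('k \<Rightarrow> 'v::ab_group_add \<Rightarrow> 'v) \<Rightarrow> ('v \<Rightarrow> 'v)
    \<Rightarrow> ('g \<Rightarrow> 'g \<Rightarrow> 'v \<Rightarrow> 'v) \<Rightarrow> ('g \<Rightarrow> 'g \<Rightarrow> 'v \<Rightarrow> 'v) \<Rightarrow> nat \<Rightarrow> ('g, 'v) cochain list rel" where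
  "cohomologous sg b1 b2 \<alpha> sv \<beta> \<theta>1 \<theta>2 n =
     {(fs, gs). fs \<in> cocycles_c sg b1 b2 \<alpha> sv \<beta> \<theta>1 \<theta>2 n \<and> gs \<in> cocycles_c sg b1 b2 \<alpha> sv \<beta> \<theta>1 \<theta>2 n \<and>
        map2 (-) fs gs \<in> coboundary_c b1 b2 \<alpha> sv \<theta>1 \<theta>2 (n - 1) ` cochains_c sg \<alpha> sv \<beta> (n - 1)}"

definition cohomology_c ::
  "('k::field \<Rightarrow> 'g::ab_group_add \<Rightarrow> 'g) \<Rightarrow> ('g \<Rightarrow> 'g \<Rightarrow> 'g \<Rightarrow> 'g) \<Rightarrow> ('g \<Rightarrow> 'g \<Rightarrow> 'g \<Rightarrow> 'g) \<Rightarrow> ('g \<Rightarrow> 'g)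
    \<Rightarrow> ('k \<Rightarrow> 'v::ab_group_add \<Rightarrow> 'v) \<Rightarrow> ('v \<Rightarrow> 'v)
    \<Rightarrow> ('g \<Rightarrow> 'g \<Rightarrow> 'v \<Rightarrow> 'v) \<Rightarrow> ('g \<Rightarrow> 'g \<Rightarrow> 'v \<Rightarrow> 'v) \<Rightarrow> nat \<Rightarrow> ('g, 'v) cochain list set set" where
  "cohomology_c sg b1 b2 \<alpha> sv \<beta> \<theta>1 \<theta>2 n =
     cocycles_c sg b1 b2 \<alpha> sv \<beta> \<theta>1 \<theta>2 n // cohomologous sg b1 b2 \<alpha> sv \<beta> \<theta>1 \<theta>2 n"


section \<open>Abelian extensions\<close>

record ('k, 'g, 'v, 'e) extension =
  total :: "('k, 'e) chlts"
  incl :: "'v \<Rightarrow> 'e"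
  proj :: "'e \<Rightarrow> 'g"

definition abelian_extension ::
  "('k::field, 'g::ab_group_add) chlts \<Rightarrow> ('k, 'v::ab_group_add) chlts
    \<Rightarrow> ('k, 'g, 'v, 'e) extension \<Rightarrow> bool" where
  "abelian_extension G V E \<longleftrightarrow>
     (let L = total E; i = incl E; p = proj E in
      compatible_hom_lts L \<and>
      chlts_hom V L i \<and> chlts_hom L G p \<and>
      inj_on i (carrier V) \<and> i ` carrier V = {x \<in> carrier L. p x = \<zero>\<^bsub>G\<^esub>} \<and> p ` carrier L = carrier G \<and>
      (\<forall>u\<in>carrier V. \<forall>v\<in>carrier V. \<forall>x\<in>carrier L.
         bracket1 L (i u) (i v) x = \<zero>\<^bsub>L\<^esub> \<and> bracket2 L (i u) (i v) x = \<zero>\<^bsub>L\<^esub>))"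

definition is_section ::
  "('k::field, 'g) chlts \<Rightarrow> ('k, 'g, 'v, 'e) extension \<Rightarrow> ('g \<Rightarrow> 'e) \<Rightarrow> bool" where
  "is_section G E \<sigma> \<longleftrightarrow> vs_hom G (total E) \<sigma> \<and> (\<forall>a\<in>carrier G. proj E (\<sigma> a) = a)"

text \<open>
  A section that is a morphism of Hom-vector spaces. These are the sections whose associated
  \<open>(\<mu>\<^sub>1, \<mu>\<^sub>2)\<close> satisfies \<open>\<beta> \<circ> \<mu>\<^sub>i = \<mu>\<^sub>i \<circ> \<alpha>\<^sup>\<otimes>\<^sup>3\<close> in general, i.e. consists of cochains.
  They need not exist: for \<open>\<gg> = V = \<langle>x\<rangle>\<close> one-dimensional with identity twists, take the extension
  with zero brackets whose twist is a nontrivial Jordan block. It is not equivalent to the split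
  one, although the second cohomology vanishes.
\<close>

definition is_hom_section ::
  "('k::field, 'g) chlts \<Rightarrow> ('k, 'g, 'v, 'e) extension \<Rightarrow> ('g \<Rightarrow> 'e) \<Rightarrow> bool" where
  "is_hom_section G E \<sigma> \<longleftrightarrow>
     is_section G E \<sigma> \<and> (\<forall>a\<in>carrier G. \<sigma> (twist G a) = twist (total E) (\<sigma> a))"

text \<open>
  Independence of the section is part of the definition: it does not follow from
  \<open>[u, v, -] = 0\<close> alone, and is what makes \<open>V\<close> an abelian ideal, i.e. \<open>[u, -, v] = 0\<close> as well.
\<close>

definition induces ::
  "('k::field, 'g) chlts \<Rightarrow> ('k, 'v) chlts \<Rightarrow> ('k, 'g, 'v, 'e) extension
    \<Rightarrow> ('g \<Rightarrow> 'g \<Rightarrow> 'v \<Rightarrow> 'v) \<Rightarrow> ('g \<Rightarrow> 'g \<Rightarrow> 'v \<Rightarrow> 'v) \<Rightarrow> bool" where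
  "induces G V E \<theta>1 \<theta>2 \<longleftrightarrow>
     (\<forall>\<sigma>. is_section G E \<sigma> \<longrightarrow>
        (\<forall>a\<in>carrier G. \<forall>b\<in>carrier G. \<forall>u\<in>carrier V.
           incl E (\<theta>1 a b u) = bracket1 (total E) (incl E u) (\<sigma> a) (\<sigma> b) \<and>
           incl E (\<theta>2 a b u) = bracket2 (total E) (incl E u) (\<sigma> a) (\<sigma> b)))"

definition equivalent_ext ::
  "('k, 'g, 'v, 'e) extension \<Rightarrow> ('k, 'v) chlts \<Rightarrow> ('k, 'g, 'v, 'e) extension \<Rightarrow> bool" where
  "equivalent_ext E1 V E2 \<longleftrightarrow>
     (\<exists>\<zeta>. chlts_iso (total E1) (total E2) \<zeta> \<and>
          (\<forall>u\<in>carrier V. \<zeta> (incl E1 u) = incl E2 u) \<and>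
          (\<forall>x\<in>carrier (total E1). proj E2 (\<zeta> x) = proj E1 x))"

text \<open>
  Abelian extensions that induce the given representation and, as discussed at
  \<^const>\<open>is_hom_section\<close>, split as extensions of Hom-vector spaces.
\<close>

definition extensions_inducing ::
  "('k::field, 'g::ab_group_add) chlts \<Rightarrow> ('k, 'v::ab_group_add) chlts
    \<Rightarrow> ('g \<Rightarrow> 'g \<Rightarrow> 'v \<Rightarrow> 'v) \<Rightarrow> ('g \<Rightarrow> 'g \<Rightarrow> 'v \<Rightarrow> 'v) \<Rightarrow> ('k, 'g, 'v, 'e) extension set" where
  "extensions_inducing G V \<theta>1 \<theta>2 =
     {E. abelian_extension G V E \<and> (\<exists>\<sigma>. is_hom_section G E \<sigma>) \<and> induces G V E \<theta>1 \<theta>2}"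

definition equivalence_rel ::
  "('k::field, 'g::ab_group_add) chlts \<Rightarrow> ('k, 'v::ab_group_add) chlts
    \<Rightarrow> ('g \<Rightarrow> 'g \<Rightarrow> 'v \<Rightarrow> 'v) \<Rightarrow> ('g \<Rightarrow> 'g \<Rightarrow> 'v \<Rightarrow> 'v) \<Rightarrow> ('k, 'g, 'v, 'e) extension rel" where
  "equivalence_rel G V \<theta>1 \<theta>2 =
     {(E1, E2). E1 \<in> extensions_inducing G V \<theta>1 \<theta>2 \<and> E2 \<in> extensions_inducing G V \<theta>1 \<theta>2 \<and>
        equivalent_ext E1 V E2}"

text \<open>
  The 2-cochain \<open>\<mu>(a, b, c) = [\<sigma> a, \<sigma> b, \<sigma> c] - \<sigma> [a, b, c]\<close> for one of the brackets, read in
  \<open>V\<close> through the inclusion.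
\<close>

definition section_cochain ::
  "('k, 'g, 'v::ab_group_add, 'e) extension \<Rightarrow> ('e \<Rightarrow> 'e \<Rightarrow> 'e \<Rightarrow> 'e) \<Rightarrow> ('g \<Rightarrow> 'g \<Rightarrow> 'g \<Rightarrow> 'g) \<Rightarrow> ('g \<Rightarrow> 'e)
    \<Rightarrow> ('g, 'v) cochain" where
  "section_cochain E brE br \<sigma> As c =
     (case As of
        [(a, b)] \<Rightarrow> the_inv (incl E) (brE (\<sigma> a) (\<sigma> b) (\<sigma> c) \<ominus>\<^bsub>total E\<^esub> \<sigma> (br a b c))
      | _ \<Rightarrow> 0)"

definition section_cocycle ::
  "('k, 'g) chlts \<Rightarrow> ('k, 'g, 'v::ab_group_add, 'e) extension \<Rightarrow> ('g \<Rightarrow> 'e) \<Rightarrow> ('g, 'v) cochain list" where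
  "section_cocycle G E \<sigma> =
     [section_cochain E (bracket1 (total E)) (bracket1 G) \<sigma>,
      section_cochain E (bracket2 (total E)) (bracket2 G) \<sigma>]"

end

theory Submission
  imports Defs "HOL-Library.Product_Plus"
begin

text \<open>
  A section \<open>\<sigma>\<close> commuting with the twists identifies an extension with \<open>\<gg> \<times> V\<close>. Since \<open>V\<close> is an
  abelian ideal acted on through \<open>\<theta>\<close>, multilinearity leaves only
  \<open>[(x, u), (y, v), (z, w)] = ([x, y, z], \<theta>(y, z) u - \<theta>(x, z) v + D(x, y) w + \<mu>(x, y, z))\<close>
  for the two brackets, with \<open>\<mu>\<close> the cochain of \<open>\<sigma>\<close>. The \<open>V\<close>-component of the fundamental
  identity for such brackets splits into a part linear in each argument from \<open>V\<close>, which vanishes by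
  the axioms of a representation together with the mixed identity, and a part independent of \<open>V\<close>,
  which is the coboundary of \<open>\<mu>\<close>. An equivalence between two extensions in this form is
  \<open>(a, u) \<mapsto> (a, u + f a)\<close> with \<open>f\<close> a 1-cochain, and it intertwines the brackets exactly when the
  2-cocycles differ by the coboundary of \<open>f\<close>.
\<close>

text \<open>An extension lives on a carrier set in a type \<open>'e\<close> of its own, while the
  computation takes place on the type \<open>'g \<times> 'v\<close>, where module arithmetic becomes
  \<open>+\<close> and \<open>0\<close>. The passage between the two is transport of structure along
  a bijection whose target is at first a bare record, not known to satisfy any axiom. This shapes
  the transport lemmas: all axioms are pushed forward from the source, and preservation of zero is a
  hypothesis of its own. In the opposite direction an injection of \<open>'g \<times> 'v\<close>
  into \<open>'e\<close> realises each cocycle inside \<open>'e\<close>.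

  In the compatibility identity, the terms linear in one of its three inner arguments from
  \<open>V\<close> amount to \<open>mixed_rep_identity\<close>. They involve the actions and the
  brackets but no cochain, so the identity is a condition on the representation alone: if one
  extension exists, it holds, and then every cocycle comes from an extension. If it holds, the zero
  cocycle already provides one, the semidirect product.\<close>

section \<open>Transport along isomorphisms\<close>

lemma carrier_ring_of_type_algebra [simp]:
  "carrier (ring_of_type_algebra :: 'k::field ring) = UNIV"
  and add_ring_of_type_algebra [simp]:
  "x \<oplus>\<^bsub>(ring_of_type_algebra :: 'k::field ring)\<^esub> y = x + y"
  and mult_ring_of_type_algebra [simp]:
  "x \<otimes>\<^bsub>(ring_of_type_algebra :: 'k::field ring)\<^esub> y = x * y"
  and one_ring_of_type_algebra [simp]:
  "\<one>\<^bsub>(ring_of_type_algebra :: 'k::field ring)\<^esub> = 1"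
  by (simp_all add: ring_of_type_algebra_def)

lemma chlts_of_simps [simp]:
  "carrier (chlts_of s c1 c2 a) = UNIV"
  "x \<oplus>\<^bsub>chlts_of s c1 c2 a\<^esub> y = x + y"
  "\<zero>\<^bsub>chlts_of s c1 c2 a\<^esub> = 0"
  "k \<odot>\<^bsub>chlts_of s c1 c2 a\<^esub> x = s k x"
  "bracket1 (chlts_of s c1 c2 a) = c1"
  "bracket2 (chlts_of s c1 c2 a) = c2"
  "twist (chlts_of s c1 c2 a) = a"
  by (simp_all add: chlts_of_def)

lemma abelian_group_chlts_of [simp]: "abelian_group (chlts_of s c1 c2 a)"
  by (rule abelian_groupI) (auto simp: algebra_simps intro: exI[of _ "- x" for x])

lemma a_minus_chlts_of [simp]: "x \<ominus>\<^bsub>chlts_of s c1 c2 a\<^esub> y = x - y"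
proof -
  interpret abelian_group "chlts_of s c1 c2 a" by simp
  have "\<ominus>\<^bsub>chlts_of s c1 c2 a\<^esub> y = - y"
    by (rule minus_equality) simp_all
  then show ?thesis by (simp add: a_minus_def)
qed

text \<open>The bridge from modules over \<open>ring_of_type_algebra\<close> to the locale
  \<open>vector_space\<close>; it lets the algebra on the product use type-class arithmetic.\<close>

lemma module_chlts_of:
  fixes s :: "'k::field \<Rightarrow> 'a::ab_group_add \<Rightarrow> 'a"
  shows "Module.module (ring_of_type_algebra :: 'k ring) (chlts_of s c1 c2 a) \<longleftrightarrow> vector_space s"
proof
  assume "Module.module (ring_of_type_algebra :: 'k ring) (chlts_of s c1 c2 a)"
  then interpret M: Module.module "ring_of_type_algebra :: 'k ring" "chlts_of s c1 c2 a" .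
  show "vector_space s"
    by standard
      (use M.smult_r_distr M.smult_l_distr M.smult_assoc1 M.smult_one in simp_all)
next
  assume "vector_space s"
  then interpret vector_space s .
  show "Module.module (ring_of_type_algebra :: 'k ring) (chlts_of s c1 c2 a)"
    by (rule moduleI) (auto simp: scale_left_distrib scale_right_distrib)
qed

lemma linear_iff':
  "Vector_Spaces.linear s t f \<longleftrightarrow> vector_space s \<and> vector_space t \<and>
     (\<forall>x y. f (x + y) = f x + f y) \<and> (\<forall>k x. f (s k x) = t k (f x))"
  by (auto simp: Vector_Spaces.linear_def module_hom_def module_hom_axioms_def
      module_iff_vector_space)

lemma vs_hom_chlts_of:
  assumes "vector_space s" "vector_space t"
  shows "vs_hom (chlts_of s c1 c2 a) (chlts_of t d1 d2 b) f \<longleftrightarrow> Vector_Spaces.linear s t f"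
  using assms by (simp add: vs_hom_def linear_iff')

lemma vs_hom_add: "vs_hom L M f \<Longrightarrow> x \<in> carrier L \<Longrightarrow> y \<in> carrier L \<Longrightarrow> f (x \<oplus>\<^bsub>L\<^esub> y) = f x \<oplus>\<^bsub>M\<^esub> f y"
  and vs_hom_smult: "vs_hom L M f \<Longrightarrow> x \<in> carrier L \<Longrightarrow> f (k \<odot>\<^bsub>L\<^esub> x) = k \<odot>\<^bsub>M\<^esub> f x"
  and vs_hom_closed: "vs_hom L M f \<Longrightarrow> x \<in> carrier L \<Longrightarrow> f x \<in> carrier M"
  by (auto simp: vs_hom_def)

lemma vs_hom_zero:
  assumes "vs_hom L M f" "abelian_group L" "abelian_group M"
  shows "f \<zero>\<^bsub>L\<^esub> = \<zero>\<^bsub>M\<^esub>"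
proof -
  interpret L: abelian_group L by fact
  interpret M: abelian_group M by fact
  have "f \<zero>\<^bsub>L\<^esub> = f \<zero>\<^bsub>L\<^esub> \<oplus>\<^bsub>M\<^esub> f \<zero>\<^bsub>L\<^esub>"
    using vs_hom_add[OF assms(1), of "\<zero>\<^bsub>L\<^esub>" "\<zero>\<^bsub>L\<^esub>"] by simp
  then show ?thesis
    using vs_hom_closed[OF assms(1) L.zero_closed] by (metis M.add.l_cancel_one')
qed

lemma vs_hom_minus:
  assumes "vs_hom L M f" "abelian_group L" "abelian_group M" "x \<in> carrier L" "y \<in> carrier L"
  shows "f (x \<ominus>\<^bsub>L\<^esub> y) = f x \<ominus>\<^bsub>M\<^esub> f y"
proof -
  interpret L: abelian_group L by fact
  interpret M: abelian_group M by fact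
  note [simp] = vs_hom_closed[OF assms(1)] assms(4,5)
  have "f (\<ominus>\<^bsub>L\<^esub> y) \<oplus>\<^bsub>M\<^esub> f y = \<zero>\<^bsub>M\<^esub>"
    using vs_hom_add[OF assms(1), of "\<ominus>\<^bsub>L\<^esub> y" y] vs_hom_zero[OF assms(1-3)]
    by (simp add: L.l_neg)
  then have "f (\<ominus>\<^bsub>L\<^esub> y) = \<ominus>\<^bsub>M\<^esub> f y"
    by (metis M.minus_equality assms(5) vs_hom_closed[OF assms(1)] L.a_inv_closed)
  then show ?thesis
    using vs_hom_add[OF assms(1), of x "\<ominus>\<^bsub>L\<^esub> y"] by (simp add: a_minus_def)
qed

lemma vs_hom_comp: "vs_hom L M f \<Longrightarrow> vs_hom M N g \<Longrightarrow> vs_hom L N (g \<circ> f)"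
  by (auto simp: vs_hom_def Pi_iff)

text \<open>Every element of \<open>M\<close> is an image, so every axiom of \<open>M\<close> is the
  image of one of \<open>L\<close>. The equation for zero is a separate hypothesis because
  \<open>M\<close> is not yet known to be a group, so that \<open>vs_hom_zero\<close> cannot be
  applied.\<close>

lemma module_transport:
  assumes mod: "Module.module (ring_of_type_algebra :: 'k::field ring) L"
    and f: "vs_hom L M f" "f ` carrier L = carrier M" "f \<zero>\<^bsub>L\<^esub> = \<zero>\<^bsub>M\<^esub>"
  shows "Module.module (ring_of_type_algebra :: 'k ring) M"
proof -
  interpret L: Module.module "ring_of_type_algebra :: 'k ring" L by fact
  have add: "f x \<oplus>\<^bsub>M\<^esub> f y = f (x \<oplus>\<^bsub>L\<^esub> y)" if "x \<in> carrier L" "y \<in> carrier L" for x y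
    using vs_hom_add[OF f(1)] that by simp
  have sc: "k \<odot>\<^bsub>M\<^esub> f x = f (k \<odot>\<^bsub>L\<^esub> x)" if "x \<in> carrier L" for x k
    using vs_hom_smult[OF f(1)] that by simp
  have ex: "\<exists>x\<in>carrier L. y = f x" if "y \<in> carrier M" for y
    using f(2) that by auto
  note [simp] = add sc f(3)[symmetric] L.smult_closed[simplified]
  have cl: "f x \<in> carrier M" if "x \<in> carrier L" for x
    using f(2) that by auto
  show ?thesis
  proof (rule moduleI)
    show "abelian_group M"
    proof (rule abelian_groupI)
      fix x assume "x \<in> carrier M"
      then obtain a where a: "x = f a" "a \<in> carrier L" using ex by blast
      then have "f (\<ominus>\<^bsub>L\<^esub> a) \<oplus>\<^bsub>M\<^esub> x = \<zero>\<^bsub>M\<^esub>" by (simp add: L.M.l_neg)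
      then show "\<exists>y\<in>carrier M. y \<oplus>\<^bsub>M\<^esub> x = \<zero>\<^bsub>M\<^esub>" using cl a by blast
    qed (use cl in \<open>auto dest!: ex simp: L.M.a_ac\<close>)
  next
    fix k l x y
    assume "x \<in> carrier M" "y \<in> carrier M"
    then obtain a b where ab: "x = f a" "y = f b" "a \<in> carrier L" "b \<in> carrier L"
      using ex by meson
    show "k \<odot>\<^bsub>M\<^esub> (x \<oplus>\<^bsub>M\<^esub> y) = k \<odot>\<^bsub>M\<^esub> x \<oplus>\<^bsub>M\<^esub> k \<odot>\<^bsub>M\<^esub> y"
      using ab L.smult_r_distr[of k a b] by simp
  next
    fix k l x
    assume "x \<in> carrier M"
    then obtain a where a: "x = f a" "a \<in> carrier L"
      using ex by meson
    show "k \<odot>\<^bsub>M\<^esub> x \<in> carrier M"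
      using a cl by simp
    show "(k \<oplus>\<^bsub>ring_of_type_algebra\<^esub> l) \<odot>\<^bsub>M\<^esub> x = k \<odot>\<^bsub>M\<^esub> x \<oplus>\<^bsub>M\<^esub> l \<odot>\<^bsub>M\<^esub> x"
      using a L.smult_l_distr[of k l a] by simp
    show "(k \<otimes>\<^bsub>ring_of_type_algebra\<^esub> l) \<odot>\<^bsub>M\<^esub> x = k \<odot>\<^bsub>M\<^esub> (l \<odot>\<^bsub>M\<^esub> x)"
      using a L.smult_assoc1[of k l a] by simp
    show "\<one>\<^bsub>ring_of_type_algebra\<^esub> \<odot>\<^bsub>M\<^esub> x = x"
      using a L.smult_one[of a] by simp
  qed auto
qed

lemma trilinear_closed:
  assumes "trilinear L b" "x \<in> carrier L" "y \<in> carrier L" "z \<in> carrier L"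
  shows "b x y z \<in> carrier L"
proof -
  have "vs_hom L L (b x y)" using assms by (simp add: trilinear_def)
  then show ?thesis using assms(4) by (rule vs_hom_closed)
qed

lemma hom_ltsD:
  assumes "hom_lts (L :: ('k::field, 'a, 'm) module_scheme) b a"
  shows "Module.module (ring_of_type_algebra :: 'k ring) L" "trilinear L b" "vs_hom L L a"
    "\<forall>x\<in>carrier L. \<forall>y\<in>carrier L. \<forall>z\<in>carrier L.
        a (b x y z) = b (a x) (a y) (a z) \<and>
        b x y z \<oplus>\<^bsub>L\<^esub> b y x z = \<zero>\<^bsub>L\<^esub> \<and>
        b x y z \<oplus>\<^bsub>L\<^esub> b z x y \<oplus>\<^bsub>L\<^esub> b y z x = \<zero>\<^bsub>L\<^esub>"
    "\<forall>c\<in>carrier L. \<forall>d\<in>carrier L. \<forall>x\<in>carrier L. \<forall>y\<in>carrier L. \<forall>z\<in>carrier L.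
        b (a c) (a d) (b x y z) =
        b (b c d x) (a y) (a z) \<oplus>\<^bsub>L\<^esub> b (a x) (b c d y) (a z) \<oplus>\<^bsub>L\<^esub> b (a x) (a y) (b c d z)"
  using assms unfolding hom_lts_def by - (elim conjE, assumption)+

lemma hom_lts_transport:
  fixes L :: "('k::field, 'a, 'm) module_scheme"
  assumes L: "hom_lts L b a"
    and f: "vs_hom L M f" "f ` carrier L = carrier M" "f \<zero>\<^bsub>L\<^esub> = \<zero>\<^bsub>M\<^esub>"
    and b: "\<And>x y z. x \<in> carrier L \<Longrightarrow> y \<in> carrier L \<Longrightarrow> z \<in> carrier L \<Longrightarrow>
      f (b x y z) = b' (f x) (f y) (f z)"
    and a: "\<And>x. x \<in> carrier L \<Longrightarrow> f (a x) = a' (f x)"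
  shows "hom_lts M b' a'"
proof -
  have mod: "Module.module (ring_of_type_algebra :: 'k ring) L" and tri: "trilinear L b"
    and va: "vs_hom L L a"
    using hom_ltsD(1-3)[OF L] by -
  interpret L: Module.module "ring_of_type_algebra :: 'k ring" L by fact
  have add: "f x \<oplus>\<^bsub>M\<^esub> f y = f (x \<oplus>\<^bsub>L\<^esub> y)" if "x \<in> carrier L" "y \<in> carrier L" for x y
    using vs_hom_add[OF f(1)] that by simp
  have sc: "k \<odot>\<^bsub>M\<^esub> f x = f (k \<odot>\<^bsub>L\<^esub> x)" if "x \<in> carrier L" for x k
    using vs_hom_smult[OF f(1)] that by simp
  have bcl: "b x y z \<in> carrier L" if "x \<in> carrier L" "y \<in> carrier L" "z \<in> carrier L" for x y z
    using trilinear_closed[OF tri that] .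
  have acl: "a x \<in> carrier L" if "x \<in> carrier L" for x
    using va that by (auto simp: vs_hom_def)
  \<comment> \<open>Oriented from \<open>M\<close> to \<open>L\<close>: an expression in images
    under \<open>f\<close> collapses to \<open>f\<close> of an expression in \<open>L\<close>, so
    each axiom of \<open>M\<close> becomes \<open>f\<close> applied to both sides of an axiom of
    \<open>L\<close>.\<close>
  note [simp] = add sc b[symmetric] a[symmetric] f(3)[symmetric] bcl acl
    L.smult_closed[simplified]
  have "trilinear M b'"
    using tri unfolding trilinear_def vs_hom_def f(2)[symmetric] by (simp add: Pi_iff)
  moreover have "vs_hom M M a'"
    using va unfolding vs_hom_def f(2)[symmetric] by (simp add: Pi_iff)
  moreover have "Module.module (ring_of_type_algebra :: 'k ring) M"
    using module_transport[OF mod f] .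
  moreover have ax1: "a' (b' x y z) = b' (a' x) (a' y) (a' z)"
      "b' x y z \<oplus>\<^bsub>M\<^esub> b' y x z = \<zero>\<^bsub>M\<^esub>"
      "b' x y z \<oplus>\<^bsub>M\<^esub> b' z x y \<oplus>\<^bsub>M\<^esub> b' y z x = \<zero>\<^bsub>M\<^esub>"
    if el: "x \<in> carrier M" "y \<in> carrier M" "z \<in> carrier M" for x y z
  proof -
    obtain x' y' z' where *: "x = f x'" "y = f y'" "z = f z'"
      "x' \<in> carrier L" "y' \<in> carrier L" "z' \<in> carrier L"
      using el unfolding f(2)[symmetric] by blast
    have "a (b x' y' z') = b (a x') (a y') (a z')" "b x' y' z' \<oplus>\<^bsub>L\<^esub> b y' x' z' = \<zero>\<^bsub>L\<^esub>"
      "b x' y' z' \<oplus>\<^bsub>L\<^esub> b z' x' y' \<oplus>\<^bsub>L\<^esub> b y' z' x' = \<zero>\<^bsub>L\<^esub>"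
      using hom_ltsD(4)[OF L, THEN bspec, THEN bspec, THEN bspec, OF *(4-6)]
      by - (elim conjE, assumption)+
    from this[THEN arg_cong[of _ _ f]] show
      "a' (b' x y z) = b' (a' x) (a' y) (a' z)"
      "b' x y z \<oplus>\<^bsub>M\<^esub> b' y x z = \<zero>\<^bsub>M\<^esub>"
      "b' x y z \<oplus>\<^bsub>M\<^esub> b' z x y \<oplus>\<^bsub>M\<^esub> b' y z x = \<zero>\<^bsub>M\<^esub>"
      unfolding *(1-3) using *(4-6) by simp_all
  qed
  moreover have ax2: "b' (a' c) (a' d) (b' x y z) = b' (b' c d x) (a' y) (a' z)
      \<oplus>\<^bsub>M\<^esub> b' (a' x) (b' c d y) (a' z) \<oplus>\<^bsub>M\<^esub> b' (a' x) (a' y) (b' c d z)"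
    if el: "c \<in> carrier M" "d \<in> carrier M" "x \<in> carrier M" "y \<in> carrier M" "z \<in> carrier M"
    for c d x y z
  proof -
    obtain c' d' x' y' z' where *: "c = f c'" "d = f d'" "x = f x'" "y = f y'" "z = f z'"
      "c' \<in> carrier L" "d' \<in> carrier L" "x' \<in> carrier L" "y' \<in> carrier L" "z' \<in> carrier L"
      using el unfolding f(2)[symmetric] by blast
    have "b (a c') (a d') (b x' y' z') = b (b c' d' x') (a y') (a z')
        \<oplus>\<^bsub>L\<^esub> b (a x') (b c' d' y') (a z') \<oplus>\<^bsub>L\<^esub> b (a x') (a y') (b c' d' z')"
      using hom_ltsD(5)[OF L, THEN bspec, THEN bspec, THEN bspec, THEN bspec, THEN bspec, OF *(6-)] .
    from arg_cong[OF this, of f] show ?thesis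
      unfolding *(1-5) using *(6-) by simp
  qed
  ultimately show ?thesis
    unfolding hom_lts_def
    by (intro conjI ballI)
      (assumption | (rule ax1; assumption) | (rule ax2; assumption))+
qed

lemma compatible_hom_ltsD:
  assumes "compatible_hom_lts L"
  shows "hom_lts L (bracket1 L) (twist L)" "hom_lts L (bracket2 L) (twist L)"
    "\<forall>a\<in>carrier L. \<forall>b\<in>carrier L. \<forall>x\<in>carrier L. \<forall>y\<in>carrier L. \<forall>z\<in>carrier L.
       bracket1 L (twist L a) (twist L b) (bracket2 L x y z)
       \<oplus>\<^bsub>L\<^esub> bracket2 L (twist L a) (twist L b) (bracket1 L x y z) =
       bracket2 L (bracket1 L a b x) (twist L y) (twist L z)
       \<oplus>\<^bsub>L\<^esub> bracket1 L (bracket2 L a b x) (twist L y) (twist L z)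
       \<oplus>\<^bsub>L\<^esub> bracket2 L (twist L x) (bracket1 L a b y) (twist L z)
       \<oplus>\<^bsub>L\<^esub> bracket1 L (twist L x) (bracket2 L a b y) (twist L z)
       \<oplus>\<^bsub>L\<^esub> bracket2 L (twist L x) (twist L y) (bracket1 L a b z)
       \<oplus>\<^bsub>L\<^esub> bracket1 L (twist L x) (twist L y) (bracket2 L a b z)"
  using assms unfolding compatible_hom_lts_def Let_def by - (elim conjE, assumption)+

lemma compatible_hom_lts_abelian_group:
  assumes "compatible_hom_lts L"
  shows "abelian_group L"
proof -
  interpret Module.module ring_of_type_algebra L
    using hom_ltsD(1)[OF compatible_hom_ltsD(1)[OF assms]] .
  show ?thesis by (rule M.abelian_group_axioms)
qed

lemma compatible_hom_lts_closed:
  assumes "compatible_hom_lts L"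
  shows "x \<in> carrier L \<Longrightarrow> y \<in> carrier L \<Longrightarrow> z \<in> carrier L \<Longrightarrow> bracket1 L x y z \<in> carrier L"
    and "x \<in> carrier L \<Longrightarrow> y \<in> carrier L \<Longrightarrow> z \<in> carrier L \<Longrightarrow> bracket2 L x y z \<in> carrier L"
    and "x \<in> carrier L \<Longrightarrow> twist L x \<in> carrier L"
    and "x \<in> carrier L \<Longrightarrow> k \<odot>\<^bsub>L\<^esub> x \<in> carrier L"
proof -
  note h = compatible_hom_ltsD(1,2)[OF assms]
  interpret Module.module ring_of_type_algebra L
    using hom_ltsD(1)[OF h(1)] .
  show "x \<in> carrier L \<Longrightarrow> y \<in> carrier L \<Longrightarrow> z \<in> carrier L \<Longrightarrow> bracket1 L x y z \<in> carrier L"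
    by (rule trilinear_closed[OF hom_ltsD(2)[OF h(1)]])
  show "x \<in> carrier L \<Longrightarrow> y \<in> carrier L \<Longrightarrow> z \<in> carrier L \<Longrightarrow> bracket2 L x y z \<in> carrier L"
    by (rule trilinear_closed[OF hom_ltsD(2)[OF h(2)]])
  show "x \<in> carrier L \<Longrightarrow> twist L x \<in> carrier L"
    by (rule vs_hom_closed[OF hom_ltsD(3)[OF h(1)]])
  show "x \<in> carrier L \<Longrightarrow> k \<odot>\<^bsub>L\<^esub> x \<in> carrier L"
    by (simp add: smult_closed)
qed

lemma compatible_hom_lts_transport:
  assumes L: "compatible_hom_lts L"
    and f: "chlts_hom L M f" "f ` carrier L = carrier M" "f \<zero>\<^bsub>L\<^esub> = \<zero>\<^bsub>M\<^esub>"
  shows "compatible_hom_lts M"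
proof -
  have v: "vs_hom L M f" using f by (simp add: chlts_hom_def)
  interpret L: abelian_group L using compatible_hom_lts_abelian_group[OF L] .
  have add: "f x \<oplus>\<^bsub>M\<^esub> f y = f (x \<oplus>\<^bsub>L\<^esub> y)" if "x \<in> carrier L" "y \<in> carrier L" for x y
    using vs_hom_add[OF v] that by simp
  have b: "bracket1 M (f x) (f y) (f z) = f (bracket1 L x y z)"
    "bracket2 M (f x) (f y) (f z) = f (bracket2 L x y z)"
    if "x \<in> carrier L" "y \<in> carrier L" "z \<in> carrier L" for x y z
    using f(1) that by (auto simp: chlts_hom_def)
  have t: "twist M (f x) = f (twist L x)" if "x \<in> carrier L" for x
    using f(1) that by (auto simp: chlts_hom_def)
  have "hom_lts M (bracket1 M) (twist M)"
    by (rule hom_lts_transport[OF compatible_hom_ltsD(1)[OF L] v f(2,3)]) (simp_all add: b t)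
  moreover have "hom_lts M (bracket2 M) (twist M)"
    by (rule hom_lts_transport[OF compatible_hom_ltsD(2)[OF L] v f(2,3)]) (simp_all add: b t)
  moreover have comp: "b1 (\<alpha> c) (\<alpha> d) (b2 x y z) \<oplus>\<^bsub>M\<^esub> b2 (\<alpha> c) (\<alpha> d) (b1 x y z) =
      b2 (b1 c d x) (\<alpha> y) (\<alpha> z) \<oplus>\<^bsub>M\<^esub> b1 (b2 c d x) (\<alpha> y) (\<alpha> z)
      \<oplus>\<^bsub>M\<^esub> b2 (\<alpha> x) (b1 c d y) (\<alpha> z) \<oplus>\<^bsub>M\<^esub> b1 (\<alpha> x) (b2 c d y) (\<alpha> z)
      \<oplus>\<^bsub>M\<^esub> b2 (\<alpha> x) (\<alpha> y) (b1 c d z) \<oplus>\<^bsub>M\<^esub> b1 (\<alpha> x) (\<alpha> y) (b2 c d z)"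
    if M: "b1 = bracket1 M" "b2 = bracket2 M" "\<alpha> = twist M"
      and el: "c \<in> carrier M" "d \<in> carrier M" "x \<in> carrier M" "y \<in> carrier M" "z \<in> carrier M"
    for c d x y z b1 b2 \<alpha>
  proof -
    obtain c' d' x' y' z' where *: "c = f c'" "d = f d'" "x = f x'" "y = f y'" "z = f z'"
      "c' \<in> carrier L" "d' \<in> carrier L" "x' \<in> carrier L" "y' \<in> carrier L" "z' \<in> carrier L"
      using el unfolding f(2)[symmetric] by blast
    define d1 d2 a where L_def: "d1 = bracket1 L" "d2 = bracket2 L" "a = twist L"
    have "d1 (a c') (a d') (d2 x' y' z') \<oplus>\<^bsub>L\<^esub> d2 (a c') (a d') (d1 x' y' z') =
      d2 (d1 c' d' x') (a y') (a z') \<oplus>\<^bsub>L\<^esub> d1 (d2 c' d' x') (a y') (a z')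
      \<oplus>\<^bsub>L\<^esub> d2 (a x') (d1 c' d' y') (a z') \<oplus>\<^bsub>L\<^esub> d1 (a x') (d2 c' d' y') (a z')
      \<oplus>\<^bsub>L\<^esub> d2 (a x') (a y') (d1 c' d' z') \<oplus>\<^bsub>L\<^esub> d1 (a x') (a y') (d2 c' d' z')"
      unfolding L_def
      using compatible_hom_ltsD(3)[OF L, THEN bspec, THEN bspec, THEN bspec, THEN bspec, THEN bspec, OF *(6-)] .
    from arg_cong[OF this, of f] show ?thesis
      unfolding *(1-5) M L_def by (simp add: add b t compatible_hom_lts_closed[OF L] *(6-))
  qed
  ultimately show ?thesis
    unfolding compatible_hom_lts_def Let_def
    by (intro conjI ballI) (assumption | (rule comp; (rule refl | assumption)))+
qed

section \<open>Equivalences of extensions: composition, inversion, transport\<close>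

definition ext_iso ::
  "('k, 'v, 'm) module_scheme \<Rightarrow> ('k, 'g, 'v, 'e) extension \<Rightarrow> ('k, 'g, 'v, 'f) extension
    \<Rightarrow> ('e \<Rightarrow> 'f) \<Rightarrow> bool" where
  "ext_iso V E1 E2 f \<longleftrightarrow> chlts_iso (total E1) (total E2) f \<and>
     (\<forall>u\<in>carrier V. f (incl E1 u) = incl E2 u) \<and>
     (\<forall>x\<in>carrier (total E1). proj E2 (f x) = proj E1 x)"

lemma equivalent_ext_iff: "equivalent_ext E1 V E2 \<longleftrightarrow> (\<exists>f. ext_iso V E1 E2 f)"
  by (simp add: equivalent_ext_def ext_iso_def)

lemma ext_iso_id: "ext_iso V E E id"
  by (simp add: ext_iso_def chlts_iso_def chlts_hom_def vs_hom_def)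

lemma ext_iso_comp:
  assumes "ext_iso V E1 E2 f" "ext_iso V E2 E3 g"
  shows "ext_iso V E1 E3 (g \<circ> f)"
proof -
  have cl: "f x \<in> carrier (total E2)" if "x \<in> carrier (total E1)" for x
    using assms(1) that unfolding ext_iso_def chlts_iso_def chlts_hom_def
    by (metis vs_hom_closed)
  show ?thesis
    using assms vs_hom_comp[of "total E1" "total E2" f "total E3" g]
      bij_betw_trans[of f "carrier (total E1)" "carrier (total E2)" g]
    unfolding ext_iso_def chlts_iso_def chlts_hom_def by (simp add: cl)
qed

text \<open>The axioms, and with them closure, are available for \<open>L\<close> only, so each
  operation of \<open>M\<close> is first rewritten as \<open>f\<close> of an operation of
  \<open>L\<close> and then cancelled against the inverse.\<close>

lemma chlts_iso_inv:
  assumes L: "compatible_hom_lts L" and f: "chlts_iso L M f"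
  shows "chlts_iso M L (inv_into (carrier L) f)"
proof -
  have hom: "chlts_hom L M f" and bij: "bij_betw f (carrier L) (carrier M)"
    and v: "vs_hom L M f"
    using f by (auto simp: chlts_iso_def chlts_hom_def)
  have inj: "inj_on f (carrier L)" and im: "carrier M = f ` carrier L"
    using bij by (auto simp: bij_betw_def)
  let ?g = "inv_into (carrier L) f"
  interpret L: abelian_group L using compatible_hom_lts_abelian_group[OF L] .
  have [simp]: "?g (f x) = x" if "x \<in> carrier L" for x
    using that inj by simp
  have "f x \<oplus>\<^bsub>M\<^esub> f y = f (x \<oplus>\<^bsub>L\<^esub> y)" if "x \<in> carrier L" "y \<in> carrier L" for x y
    using vs_hom_add[OF v] that by simp
  moreover have "k \<odot>\<^bsub>M\<^esub> f x = f (k \<odot>\<^bsub>L\<^esub> x)" if "x \<in> carrier L" for x k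
    using vs_hom_smult[OF v] that by simp
  moreover have "bracket1 M (f x) (f y) (f z) = f (bracket1 L x y z)"
    "bracket2 M (f x) (f y) (f z) = f (bracket2 L x y z)"
    if "x \<in> carrier L" "y \<in> carrier L" "z \<in> carrier L" for x y z
    using hom that by (auto simp: chlts_hom_def)
  moreover have "twist M (f x) = f (twist L x)" if "x \<in> carrier L" for x
    using hom that by (auto simp: chlts_hom_def)
  ultimately have "chlts_hom M L ?g"
    unfolding chlts_hom_def vs_hom_def im
    by (simp add: compatible_hom_lts_closed[OF L] Pi_iff)
  then show ?thesis
    using bij by (simp add: chlts_iso_def bij_betw_inv_into)
qed

lemma abelian_extension_simps:
  "abelian_extension G V E \<longleftrightarrow>
      compatible_hom_lts (total E) \<and>
      chlts_hom V (total E) (incl E) \<and> chlts_hom (total E) G (proj E) \<and>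
      inj_on (incl E) (carrier V) \<and>
      incl E ` carrier V = {x \<in> carrier (total E). proj E x = \<zero>\<^bsub>G\<^esub>} \<and>
      proj E ` carrier (total E) = carrier G \<and>
      (\<forall>u\<in>carrier V. \<forall>v\<in>carrier V. \<forall>x\<in>carrier (total E).
         bracket1 (total E) (incl E u) (incl E v) x = \<zero>\<^bsub>total E\<^esub> \<and>
         bracket2 (total E) (incl E u) (incl E v) x = \<zero>\<^bsub>total E\<^esub>)"
  by (simp add: abelian_extension_def Let_def)

lemma ext_iso_inv:
  assumes E: "abelian_extension G V E" and f: "ext_iso V E E' f"
  shows "ext_iso V E' E (inv_into (carrier (total E)) f)"
proof -
  have c: "compatible_hom_lts (total E)" using E by (simp add: abelian_extension_simps)
  have bij: "bij_betw f (carrier (total E)) (carrier (total E'))"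
    and iso: "chlts_iso (total E) (total E') f"
    and i: "\<And>u. u \<in> carrier V \<Longrightarrow> incl E' u = f (incl E u)"
    and p: "\<And>x. x \<in> carrier (total E) \<Longrightarrow> proj E' (f x) = proj E x"
    using f by (auto simp: ext_iso_def chlts_iso_def)
  have inj: "inj_on f (carrier (total E))" and im: "carrier (total E') = f ` carrier (total E)"
    using bij by (auto simp: bij_betw_def)
  have icl: "incl E u \<in> carrier (total E)" if "u \<in> carrier V" for u
    using E that by (auto simp: abelian_extension_simps)
  show ?thesis
    unfolding ext_iso_def im using chlts_iso_inv[OF c iso] inj icl i p by simp
qed

lemma abelian_extension_transport:
  assumes E: "abelian_extension G V E" and f: "ext_iso V E E' f"
    and z: "f \<zero>\<^bsub>total E\<^esub> = \<zero>\<^bsub>total E'\<^esub>"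
    and V: "V = chlts_of s c1 c2 a"
  shows "abelian_extension G V E'"
proof -
  have c: "compatible_hom_lts (total E)" using E by (simp add: abelian_extension_simps)
  interpret L: abelian_group "total E" using compatible_hom_lts_abelian_group[OF c] .
  have bij: "bij_betw f (carrier (total E)) (carrier (total E'))"
    and hom: "chlts_hom (total E) (total E') f" and v: "vs_hom (total E) (total E') f"
    and i: "\<And>u. u \<in> carrier V \<Longrightarrow> incl E' u = f (incl E u)"
    and p: "\<And>x. x \<in> carrier (total E) \<Longrightarrow> proj E' (f x) = proj E x"
    using f by (auto simp: ext_iso_def chlts_iso_def chlts_hom_def)
  have inj: "inj_on f (carrier (total E))" and im: "carrier (total E') = f ` carrier (total E)"
    using bij by (auto simp: bij_betw_def)
  have icl: "incl E u \<in> carrier (total E)" if "u \<in> carrier V" for u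
    using E that by (auto simp: abelian_extension_simps)
  have c': "compatible_hom_lts (total E')"
    by (rule compatible_hom_lts_transport[OF c hom im[symmetric] z])
  have add: "f x \<oplus>\<^bsub>total E'\<^esub> f y = f (x \<oplus>\<^bsub>total E\<^esub> y)"
    if "x \<in> carrier (total E)" "y \<in> carrier (total E)" for x y
    using vs_hom_add[OF v] that by simp
  have sc: "k \<odot>\<^bsub>total E'\<^esub> f x = f (k \<odot>\<^bsub>total E\<^esub> x)" if "x \<in> carrier (total E)" for x k
    using vs_hom_smult[OF v] that by simp
  have b: "bracket1 (total E') (f x) (f y) (f z) = f (bracket1 (total E) x y z)"
    "bracket2 (total E') (f x) (f y) (f z) = f (bracket2 (total E) x y z)"
    if "x \<in> carrier (total E)" "y \<in> carrier (total E)" "z \<in> carrier (total E)" for x y z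
    using hom that by (auto simp: chlts_hom_def)
  have t: "twist (total E') (f x) = f (twist (total E) x)" if "x \<in> carrier (total E)" for x
    using hom that by (auto simp: chlts_hom_def)
  note [simp] = add sc b t icl i p z[symmetric] compatible_hom_lts_closed[OF c] 
  have hV: "chlts_hom V (total E) (incl E)" and hG: "chlts_hom (total E) G (proj E)"
    and inji: "inj_on (incl E) (carrier V)"
    and ker: "incl E ` carrier V = {x \<in> carrier (total E). proj E x = \<zero>\<^bsub>G\<^esub>}"
    and sur: "proj E ` carrier (total E) = carrier G"
    and ab: "\<And>u v x. u \<in> carrier V \<Longrightarrow> v \<in> carrier V \<Longrightarrow> x \<in> carrier (total E) \<Longrightarrow>
       bracket1 (total E) (incl E u) (incl E v) x = \<zero>\<^bsub>total E\<^esub> \<and>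
         bracket2 (total E) (incl E u) (incl E v) x = \<zero>\<^bsub>total E\<^esub>"
    using E by (simp_all add: abelian_extension_simps)
  have "chlts_hom V (total E') (incl E')"
    using hV unfolding chlts_hom_def vs_hom_def im by (simp add: Pi_iff V)
  moreover have "chlts_hom (total E') G (proj E')"
    using hG unfolding chlts_hom_def vs_hom_def im by (simp add: Pi_iff)
  moreover have "inj_on (incl E') (carrier V)"
    using inji inj by (auto simp: inj_on_def)
  moreover have "incl E' ` carrier V = {x \<in> carrier (total E'). proj E' x = \<zero>\<^bsub>G\<^esub>}"
  proof -
    \<comment> \<open>Exactness carries over because \<open>f\<close> maps the kernel of
      \<open>proj E\<close> onto the kernel of \<open>proj E'\<close>.\<close>
    have "incl E' ` carrier V = f ` incl E ` carrier V"
      by (simp add: image_image)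
    then show ?thesis unfolding ker im by auto
  qed
  moreover have "proj E' ` carrier (total E') = carrier G"
    unfolding im image_image using sur by (simp cong: image_cong)
  ultimately show ?thesis
    unfolding abelian_extension_simps using c' ab by (simp add: im)
qed

section \<open>Brackets on the product\<close>

text \<open>Outer and inner bracket are separate arguments: for equal brackets this is the failure
  of the fundamental identity, and the two mixed values for a pair of brackets add up to the failure
  of compatibility.\<close>

definition jacobi_defect ::
  "('a \<Rightarrow> 'a \<Rightarrow> 'a \<Rightarrow> 'a::ab_group_add) \<Rightarrow> ('a \<Rightarrow> 'a \<Rightarrow> 'a \<Rightarrow> 'a) \<Rightarrow> ('a \<Rightarrow> 'a)
    \<Rightarrow> 'a \<Rightarrow> 'a \<Rightarrow> 'a \<Rightarrow> 'a \<Rightarrow> 'a \<Rightarrow> 'a" where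
  "jacobi_defect br br' \<tau> a b x y z =
     br (\<tau> a) (\<tau> b) (br' x y z) - br (br' a b x) (\<tau> y) (\<tau> z)
     - br (\<tau> x) (br' a b y) (\<tau> z) - br (\<tau> x) (\<tau> y) (br' a b z)"

text \<open>The target space is allowed to differ from the source, so that one notion serves both
  brackets and 2-cochains.\<close>

definition type_trilinear ::
  "('k::field \<Rightarrow> 'a::ab_group_add \<Rightarrow> 'a) \<Rightarrow> ('k \<Rightarrow> 'b::ab_group_add \<Rightarrow> 'b) \<Rightarrow>
    ('a \<Rightarrow> 'a \<Rightarrow> 'a \<Rightarrow> 'b) \<Rightarrow> bool" where
  "type_trilinear s t m \<longleftrightarrow>
     (\<forall>x y. Vector_Spaces.linear s t (\<lambda>z. m z x y)) \<and>
     (\<forall>x y. Vector_Spaces.linear s t (\<lambda>z. m x z y)) \<and>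
     (\<forall>x y. Vector_Spaces.linear s t (\<lambda>z. m x y z))"

definition type_hom_lts ::
  "('k::field \<Rightarrow> 'a::ab_group_add \<Rightarrow> 'a) \<Rightarrow> ('a \<Rightarrow> 'a \<Rightarrow> 'a \<Rightarrow> 'a) \<Rightarrow> ('a \<Rightarrow> 'a) \<Rightarrow> bool" where
  "type_hom_lts s br \<tau> \<longleftrightarrow>
     vector_space s \<and> type_trilinear s s br \<and> Vector_Spaces.linear s s \<tau> \<and>
     (\<forall>x y z. \<tau> (br x y z) = br (\<tau> x) (\<tau> y) (\<tau> z)) \<and>
     (\<forall>x y z. br x y z + br y x z = 0) \<and>
     (\<forall>x y z. br x y z + br z x y + br y z x = 0) \<and>
     (\<forall>a b x y z. jacobi_defect br br \<tau> a b x y z = 0)"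

lemma hom_lts_chlts_of: "hom_lts (chlts_of s c1 c2 t) br \<tau> \<longleftrightarrow> type_hom_lts s br \<tau>"
proof (cases "vector_space s")
  case True
  have "trilinear (chlts_of s c1 c2 t) br \<longleftrightarrow> type_trilinear s s br"
    using True by (auto simp: trilinear_def type_trilinear_def vs_hom_chlts_of)
  moreover have "(br (\<tau> a) (\<tau> b) (br x y z) =
        br (br a b x) (\<tau> y) (\<tau> z) + br (\<tau> x) (br a b y) (\<tau> z) + br (\<tau> x) (\<tau> y) (br a b z))
      \<longleftrightarrow> jacobi_defect br br \<tau> a b x y z = 0" for a b x y z
    by (simp add: jacobi_defect_def diff_eq_eq add.commute add.left_commute)
  ultimately show ?thesis
    using True unfolding hom_lts_def type_hom_lts_def
    by (simp add: module_chlts_of vs_hom_chlts_of) blast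
qed (simp add: hom_lts_def type_hom_lts_def module_chlts_of)

lemma compatible_hom_lts_chlts_of:
  "compatible_hom_lts (chlts_of s c1 c2 \<tau>) \<longleftrightarrow>
     type_hom_lts s c1 \<tau> \<and> type_hom_lts s c2 \<tau> \<and>
     (\<forall>a b x y z. jacobi_defect c1 c2 \<tau> a b x y z + jacobi_defect c2 c1 \<tau> a b x y z = 0)"
proof -
  have "(c1 (\<tau> a) (\<tau> b) (c2 x y z) + c2 (\<tau> a) (\<tau> b) (c1 x y z) =
         c2 (c1 a b x) (\<tau> y) (\<tau> z) + c1 (c2 a b x) (\<tau> y) (\<tau> z)
         + c2 (\<tau> x) (c1 a b y) (\<tau> z) + c1 (\<tau> x) (c2 a b y) (\<tau> z)
         + c2 (\<tau> x) (\<tau> y) (c1 a b z) + c1 (\<tau> x) (\<tau> y) (c2 a b z))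
     \<longleftrightarrow> jacobi_defect c1 c2 \<tau> a b x y z + jacobi_defect c2 c1 \<tau> a b x y z = 0" for a b x y z
    unfolding jacobi_defect_def by (subst eq_iff_diff_eq_0) (simp add: algebra_simps)
  then show ?thesis
    by (simp add: compatible_hom_lts_def Let_def hom_lts_chlts_of)
qed

definition prod_scale :: "('k \<Rightarrow> 'g \<Rightarrow> 'g) \<Rightarrow> ('k \<Rightarrow> 'v \<Rightarrow> 'v) \<Rightarrow> 'k \<Rightarrow> 'g \<times> 'v \<Rightarrow> 'g \<times> 'v" where
  "prod_scale sg sv k = map_prod (sg k) (sv k)"

lemma vector_space_prod_scale:
  assumes "vector_space sg" "vector_space sv"
  shows "vector_space (prod_scale sg sv)"
proof -
  interpret sg: vector_space sg by fact
  interpret sv: vector_space sv by fact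
  show ?thesis
    by standard (auto simp: prod_scale_def algebra_simps sg.scale_right_distrib
        sg.scale_left_distrib sv.scale_right_distrib sv.scale_left_distrib)
qed

definition ext_bracket ::
  "('g \<Rightarrow> 'g \<Rightarrow> 'g \<Rightarrow> 'g) \<Rightarrow> ('g \<Rightarrow> 'g \<Rightarrow> 'v \<Rightarrow> 'v::ab_group_add) \<Rightarrow> ('g \<Rightarrow> 'g \<Rightarrow> 'g \<Rightarrow> 'v)
    \<Rightarrow> 'g \<times> 'v \<Rightarrow> 'g \<times> 'v \<Rightarrow> 'g \<times> 'v \<Rightarrow> 'g \<times> 'v" where
  "ext_bracket br \<theta> m = (\<lambda>(x, u) (y, v) (z, w).
     (br x y z, \<theta> y z u - \<theta> x z v + rep_D \<theta> x y w + m x y z))"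

lemma ext_bracket_Pair [simp]:
  "ext_bracket br \<theta> m (x, u) (y, v) (z, w) =
     (br x y z, \<theta> y z u - \<theta> x z v + rep_D \<theta> x y w + m x y z)"
  by (simp add: ext_bracket_def)

text \<open>
  The contributions to the fundamental identity for \<open>ext_bracket\<close> of its second argument (those of
  the first differ by a sign), of its fourth (those of the third and fifth follow by skew symmetry
  and the Jacobi identity), and of the cochains. Keeping the inner bracket, marked with a prime, apart
  from the outer one covers the fundamental identity and its polarisation at once.
\<close>

definition rep_defect1 where
  "rep_defect1 \<alpha> \<beta> \<theta> \<theta>' br' b x y z u =
     \<theta> (\<alpha> y) (\<alpha> z) (\<theta>' b x u) - \<theta> (\<alpha> x) (\<alpha> z) (\<theta>' b y u)
     - \<theta> (\<alpha> b) (br' x y z) (\<beta> u) + rep_D \<theta> (\<alpha> x) (\<alpha> y) (\<theta>' b z u)"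

definition rep_defect2 where
  "rep_defect2 \<alpha> \<beta> \<theta> \<theta>' br' x y a b u =
     \<theta> (\<alpha> a) (\<alpha> b) (rep_D \<theta>' x y u) - rep_D \<theta> (\<alpha> x) (\<alpha> y) (\<theta>' a b u)
     + \<theta> (br' x y a) (\<alpha> b) (\<beta> u) + \<theta> (\<alpha> a) (br' x y b) (\<beta> u)"

definition cocycle_defect where
  "cocycle_defect \<alpha> \<theta> m br' m' a b x y z =
     rep_D \<theta> (\<alpha> a) (\<alpha> b) (m' x y z) + m (\<alpha> a) (\<alpha> b) (br' x y z)
     - \<theta> (\<alpha> y) (\<alpha> z) (m' a b x) - m (br' a b x) (\<alpha> y) (\<alpha> z)
     + \<theta> (\<alpha> x) (\<alpha> z) (m' a b y) - m (\<alpha> x) (br' a b y) (\<alpha> z)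
     - rep_D \<theta> (\<alpha> x) (\<alpha> y) (m' a b z) - m (\<alpha> x) (\<alpha> y) (br' a b z)"

text \<open>A formal expansion whose only input is additivity of the outer action, needed to
  distribute it over the \<open>V\<close>-component of the inner bracket. An inner argument that
  enters the bracket through \<open>\<theta>' p q\<close> contributes minus
  \<open>rep_defect2\<close> at \<open>a b p q\<close>. This explains the signs for
  \<open>ux\<close> and \<open>uy\<close>, and the two terms for \<open>uz\<close>, which enters
  through \<open>rep_D\<close>.\<close>

lemma jacobi_defect_ext_bracket:
  fixes \<theta> \<theta>' :: "'g::ab_group_add \<Rightarrow> 'g \<Rightarrow> 'v \<Rightarrow> 'v::ab_group_add"
  assumes add: "\<And>x y u v. \<theta> x y (u + v) = \<theta> x y u + \<theta> x y v"
  shows "jacobi_defect (ext_bracket br \<theta> m) (ext_bracket br' \<theta>' m') (map_prod \<alpha> \<beta>)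
       (a, ua) (b, ub) (x, ux) (y, uy) (z, uz) =
     (jacobi_defect br br' \<alpha> a b x y z,
      rep_defect1 \<alpha> \<beta> \<theta> \<theta>' br' a x y z ub - rep_defect1 \<alpha> \<beta> \<theta> \<theta>' br' b x y z ua
      + rep_defect2 \<alpha> \<beta> \<theta> \<theta>' br' a b x z uy - rep_defect2 \<alpha> \<beta> \<theta> \<theta>' br' a b y z ux
      + rep_defect2 \<alpha> \<beta> \<theta> \<theta>' br' a b x y uz - rep_defect2 \<alpha> \<beta> \<theta> \<theta>' br' a b y x uz
      + cocycle_defect \<alpha> \<theta> m br' m' a b x y z)"
proof -
  have diff: "\<theta> x y (u - v) = \<theta> x y u - \<theta> x y v" for x y u v
    using add[of x y "u - v" v] by (simp add: algebra_simps)
  show ?thesis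
    by (simp add: jacobi_defect_def rep_defect1_def rep_defect2_def cocycle_defect_def
        rep_D_def add diff algebra_simps)
qed

text \<open>The conditions of \<open>cochains\<close> in degree 2, for a function of three
  arguments. The exterior square calls for alternation, \<open>m a a c = 0\<close>, whereas the
  bracket axioms state skew symmetry.\<close>

definition lts_cochain ::
  "('k::field \<Rightarrow> 'g::ab_group_add \<Rightarrow> 'g) \<Rightarrow> ('g \<Rightarrow> 'g) \<Rightarrow> ('k \<Rightarrow> 'v::ab_group_add \<Rightarrow> 'v) \<Rightarrow> ('v \<Rightarrow> 'v)
    \<Rightarrow> ('g \<Rightarrow> 'g \<Rightarrow> 'g \<Rightarrow> 'v) \<Rightarrow> bool" where
  "lts_cochain sg \<alpha> sv \<beta> m \<longleftrightarrow> type_trilinear sg sv m \<and> (\<forall>a c. m a a c = 0) \<and>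
     (\<forall>a b c. \<beta> (m a b c) = m (\<alpha> a) (\<alpha> b) (\<alpha> c)) \<and>
     (\<forall>a b c. m a b c + m b c a + m c a b = 0)"

text \<open>Polarisation: expand the vanishing value at \<open>a + b\<close>,
  \<open>a + b\<close>.\<close>

lemma skew_if_alternating:
  assumes "type_trilinear sg sv m" "\<And>a c. m a a c = 0"
  shows "m a b c + m b a c = 0"
proof -
  have "m (a + b) (a + b) c = m a a c + m a b c + (m b a c + m b b c)"
    using assms(1) by (simp add: type_trilinear_def linear_iff')
  then show ?thesis using assms(2) by simp
qed

text \<open>Characteristic zero enters here: it turns the skew symmetry coming from a bracket into
  the alternation required of cochains.\<close>

lemma double_eq_0:
  fixes s :: "'k::field_char_0 \<Rightarrow> 'a::ab_group_add \<Rightarrow> 'a" and v :: 'a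
  assumes "vector_space s" "v + v = 0"
  shows "v = 0"
proof -
  interpret vector_space s by fact
  have "s 2 v = 0"
    using assms(2) scale_left_distrib[of 1 1 v] by simp
  then show ?thesis by simp
qed

lemma hom_lts_repD:
  assumes "hom_lts_rep sg br \<alpha> sv \<beta> \<theta>"
  shows "Vector_Spaces.linear sv sv \<beta>" "Vector_Spaces.linear sv sv (\<theta> x y)"
    "Vector_Spaces.linear sg sv (\<lambda>y. \<theta> x y u)" "Vector_Spaces.linear sg sv (\<lambda>x. \<theta> x y u)"
    "\<theta> (\<alpha> x) (\<alpha> y) (\<beta> u) = \<beta> (\<theta> x y u)"
    "rep_defect1 \<alpha> \<beta> \<theta> \<theta> br x y z w u = 0" "rep_defect2 \<alpha> \<beta> \<theta> \<theta> br x y z w u = 0"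
  using assms unfolding hom_lts_rep_def rep_defect1_def rep_defect2_def hom_vector_space_def
  by (elim conjE; simp (no_asm_simp); blast)+

lemma linear_add_eq: "Vector_Spaces.linear s t f \<Longrightarrow> f (x + y) = f x + f y"
  and linear_scale_eq: "Vector_Spaces.linear s t f \<Longrightarrow> f (s k x) = t k (f x)"
  by (auto simp: linear_iff')

lemma linear_zero_eq: "Vector_Spaces.linear s t f \<Longrightarrow> f 0 = 0"
  and linear_diff_eq: "Vector_Spaces.linear s t f \<Longrightarrow> f (x - y) = f x - f y"
  by (simp_all add: Vector_Spaces.linear.axioms module_hom.zero module_hom.diff linear_iff_module_hom)


text \<open>Allows the arguments from \<open>V\<close> in the fundamental identity to be switched
  off one at a time.\<close>

lemma rep_defect_0:
  assumes "hom_lts_rep sg' br0 \<alpha> sv \<beta> \<theta>" "hom_lts_rep sg' br0' \<alpha> sv \<beta> \<theta>'"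
  shows "rep_defect1 \<alpha> \<beta> \<theta> \<theta>' br' b x y z 0 = 0" "rep_defect2 \<alpha> \<beta> \<theta> \<theta>' br' b x y z 0 = 0"
  using hom_lts_repD(1,2)[OF assms(1), THEN linear_zero_eq]
    hom_lts_repD(2)[OF assms(2), THEN linear_zero_eq]
  by (simp_all add: rep_defect1_def rep_defect2_def rep_D_def)

text \<open>The axioms match the conditions on \<open>m\<close> one by one. The component in the
  algebra holds by \<open>G\<close>, the terms linear in arguments from \<open>V\<close> cancel by
  \<open>rep\<close>, and what remains of each axiom is a statement about \<open>m\<close>
  alone.\<close>

lemma type_hom_lts_ext_bracket:
  fixes sg :: "'k::field_char_0 \<Rightarrow> 'g::ab_group_add \<Rightarrow> 'g"
    and sv :: "'k \<Rightarrow> 'v::ab_group_add \<Rightarrow> 'v"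
  assumes G: "type_hom_lts sg br \<alpha>" and rep: "hom_lts_rep sg br \<alpha> sv \<beta> \<theta>"
  shows "type_hom_lts (prod_scale sg sv) (ext_bracket br \<theta> m) (map_prod \<alpha> \<beta>) \<longleftrightarrow>
     lts_cochain sg \<alpha> sv \<beta> m \<and> (\<forall>a b x y z. cocycle_defect \<alpha> \<theta> m br m a b x y z = 0)"
proof -
  let ?s = "prod_scale sg sv" and ?b = "ext_bracket br \<theta> m" and ?t = "map_prod \<alpha> \<beta>"
  note D = hom_lts_repD[OF rep]
  have vg: "vector_space sg" and tri: "type_trilinear sg sg br"
    and la: "Vector_Spaces.linear sg sg \<alpha>" and ah: "\<alpha> (br x y z) = br (\<alpha> x) (\<alpha> y) (\<alpha> z)"
    and skew: "br x y z + br y x z = 0" and cyc: "br x y z + br z x y + br y z x = 0"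
    and jac: "jacobi_defect br br \<alpha> a b x y z = 0" for a b x y z
    using G by (simp_all add: type_hom_lts_def)
  have vv: "vector_space sv" using D(1) by (simp add: linear_iff')
  note add = D(1,2,3,4)[THEN linear_add_eq]
  note sc = D(1,2,3,4)[THEN linear_scale_eq]
  note zero = D(1,2,3,4)[THEN linear_zero_eq]
  note dif = D(1,2,3,4)[THEN linear_diff_eq]
  interpret sv: vector_space sv by fact
  have vs: "vector_space ?s" by (rule vector_space_prod_scale[OF vg vv])
  have lt: "Vector_Spaces.linear ?s ?s ?t"
    using D(1) la vs by (auto simp: linear_iff' prod_scale_def)
  have tri_iff: "type_trilinear ?s ?s ?b \<longleftrightarrow> type_trilinear sg sv m"
  proof
    assume *: "type_trilinear ?s ?s ?b"
    \<comment> \<open>With zero vector components the second component of \<open>?b\<close> is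
      \<open>m\<close>, so linearity of \<open>?b\<close> in each slot restricts to
      \<open>m\<close>.\<close>
    have "?b (x + x', 0) (y, 0) (z, 0) = ?b (x, 0) (y, 0) (z, 0) + ?b (x', 0) (y, 0) (z, 0)"
      "?b (y, 0) (x + x', 0) (z, 0) = ?b (y, 0) (x, 0) (z, 0) + ?b (y, 0) (x', 0) (z, 0)"
      "?b (y, 0) (z, 0) (x + x', 0) = ?b (y, 0) (z, 0) (x, 0) + ?b (y, 0) (z, 0) (x', 0)"
      for x x' y z
      using * unfolding type_trilinear_def linear_iff'
      by (metis add_Pair add.right_neutral)+
    moreover have "?b (sg k x, 0) (y, 0) (z, 0) = ?s k (?b (x, 0) (y, 0) (z, 0))"
      "?b (y, 0) (sg k x, 0) (z, 0) = ?s k (?b (y, 0) (x, 0) (z, 0))"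
      "?b (y, 0) (z, 0) (sg k x, 0) = ?s k (?b (y, 0) (z, 0) (x, 0))"
      for k x y z
    proof -
      have "(sg k x, 0) = ?s k (x, 0)" by (simp add: prod_scale_def)
      then show "?b (sg k x, 0) (y, 0) (z, 0) = ?s k (?b (x, 0) (y, 0) (z, 0))"
        "?b (y, 0) (sg k x, 0) (z, 0) = ?s k (?b (y, 0) (x, 0) (z, 0))"
        "?b (y, 0) (z, 0) (sg k x, 0) = ?s k (?b (y, 0) (z, 0) (x, 0))"
        using * unfolding type_trilinear_def linear_iff' by metis+
    qed
    ultimately show "type_trilinear sg sv m"
      using vg vv by (simp add: type_trilinear_def linear_iff' zero rep_D_def prod_scale_def)
  next
    assume *: "type_trilinear sg sv m"
    then show "type_trilinear ?s ?s ?b"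
      using vs tri
      by (auto simp: type_trilinear_def linear_iff' rep_D_def prod_scale_def add sc
        sv.scale_right_distrib sv.scale_right_diff_distrib algebra_simps)
  qed
  have hom_iff: "(\<forall>x y z. ?t (?b x y z) = ?b (?t x) (?t y) (?t z)) \<longleftrightarrow>
     (\<forall>a b c. \<beta> (m a b c) = m (\<alpha> a) (\<alpha> b) (\<alpha> c))"
    by (auto simp: rep_D_def D(5)[symmetric] add dif ah zero)
  have skew_iff: "(\<forall>x y z. ?b x y z + ?b y x z = 0) \<longleftrightarrow> (\<forall>a b c. m a b c + m b a c = 0)"
    by (auto simp: rep_D_def skew zero_prod_def zero)
  have cyc': "br x y z + (br y z x + br z x y) = 0" for x y z
    using cyc[of x y z] by (simp add: algebra_simps)
  have cyc_iff: "(\<forall>x y z. ?b x y z + ?b z x y + ?b y z x = 0) \<longleftrightarrow>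
     (\<forall>a b c. m a b c + m b c a + m c a b = 0)"
    by (auto simp: rep_D_def cyc' zero_prod_def zero algebra_simps)
  have jac_iff: "(\<forall>a b x y z. jacobi_defect ?b ?b ?t a b x y z = 0) \<longleftrightarrow>
     (\<forall>a b x y z. cocycle_defect \<alpha> \<theta> m br m a b x y z = 0)"
    by (simp add: split_paired_All jacobi_defect_ext_bracket add D jac zero_prod_def)
  have alt: "(\<forall>a c. m a a c = 0) \<longleftrightarrow> (\<forall>a b c. m a b c + m b a c = 0)" if "type_trilinear sg sv m"
    using skew_if_alternating[OF that] double_eq_0[OF vv] by metis
  show ?thesis
    unfolding type_hom_lts_def lts_cochain_def tri_iff hom_iff skew_iff cyc_iff jac_iff
    using vs lt alt by blast
qed

lemma mixed_rep_identity_iff: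
  "mixed_rep_identity b1 b2 \<alpha> \<beta> \<theta>1 \<theta>2 \<longleftrightarrow>
     (\<forall>x y a b u. rep_defect2 \<alpha> \<beta> \<theta>1 \<theta>2 b2 x y a b u + rep_defect2 \<alpha> \<beta> \<theta>2 \<theta>1 b1 x y a b u = 0)"
  by (simp add: mixed_rep_identity_def rep_defect2_def algebra_simps)

text \<open>The first mixed clause of \<open>compatible_rep\<close>, with its sign reversed, is the
  polarised first axiom. The analogous statement for \<open>rep_defect2\<close> does not follow,
  which is why \<open>mixed_rep_identity\<close> appears as a condition of its own in
  \<open>compatible_hom_lts_ext_bracket\<close>.\<close>

lemma compatible_repD:
  assumes "compatible_rep sg b1 b2 \<alpha> sv \<beta> \<theta>1 \<theta>2"
  shows "hom_lts_rep sg b1 \<alpha> sv \<beta> \<theta>1" "hom_lts_rep sg b2 \<alpha> sv \<beta> \<theta>2"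
    "rep_defect1 \<alpha> \<beta> \<theta>1 \<theta>2 b2 b x y z u + rep_defect1 \<alpha> \<beta> \<theta>2 \<theta>1 b1 b x y z u = 0"
proof -
  show "hom_lts_rep sg b1 \<alpha> sv \<beta> \<theta>1" "hom_lts_rep sg b2 \<alpha> sv \<beta> \<theta>2"
    using assms by (simp_all add: compatible_rep_def)
  have *: "\<theta>1 (\<alpha> b) (b2 x y z) (\<beta> u) + \<theta>2 (\<alpha> b) (b1 x y z) (\<beta> u)
        + \<theta>1 (\<alpha> x) (\<alpha> z) (\<theta>2 b y u) + \<theta>2 (\<alpha> x) (\<alpha> z) (\<theta>1 b y u)
        - \<theta>1 (\<alpha> y) (\<alpha> z) (\<theta>2 b x u) - \<theta>2 (\<alpha> y) (\<alpha> z) (\<theta>1 b x u)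
        - rep_D \<theta>1 (\<alpha> x) (\<alpha> y) (\<theta>2 b z u) - rep_D \<theta>2 (\<alpha> x) (\<alpha> y) (\<theta>1 b z u) = 0"
    (is "?l = 0") using assms by (simp add: compatible_rep_def)
  have "rep_defect1 \<alpha> \<beta> \<theta>1 \<theta>2 b2 b x y z u + rep_defect1 \<alpha> \<beta> \<theta>2 \<theta>1 b1 b x y z u = - ?l"
    by (simp add: rep_defect1_def algebra_simps)
  then show "rep_defect1 \<alpha> \<beta> \<theta>1 \<theta>2 b2 b x y z u + rep_defect1 \<alpha> \<beta> \<theta>2 \<theta>1 b1 b x y z u = 0"
    unfolding * by simp
qed

text \<open>The last three conditions correspond to the three entries of
  \<open>coboundary_c\<close>, up to sign. The mixed one is grouped as it falls out of the
  compatibility identity; \<open>cocycle_defect_sum_eq_0_iff\<close> regroups it into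
  coboundaries.\<close>

definition cocycle_pair where
  "cocycle_pair sg b1 b2 \<alpha> sv \<beta> \<theta>1 \<theta>2 m1 m2 \<longleftrightarrow>
     lts_cochain sg \<alpha> sv \<beta> m1 \<and> lts_cochain sg \<alpha> sv \<beta> m2 \<and>
     (\<forall>a b x y z. cocycle_defect \<alpha> \<theta>1 m1 b1 m1 a b x y z = 0) \<and>
     (\<forall>a b x y z. cocycle_defect \<alpha> \<theta>2 m2 b2 m2 a b x y z = 0) \<and>
     (\<forall>a b x y z. cocycle_defect \<alpha> \<theta>1 m1 b2 m2 a b x y z
        + cocycle_defect \<alpha> \<theta>2 m2 b1 m1 a b x y z = 0)"

text \<open>Each single bracket is settled by \<open>type_hom_lts_ext_bracket\<close>. The
  compatibility identity adds the mixed identity and the mixed cocycle condition, which are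
  separated by setting arguments from \<open>V\<close> to zero.\<close>

lemma compatible_hom_lts_ext_bracket:
  fixes sg :: "'k::field_char_0 \<Rightarrow> 'g::ab_group_add \<Rightarrow> 'g"
    and sv :: "'k \<Rightarrow> 'v::ab_group_add \<Rightarrow> 'v"
  assumes G: "compatible_hom_lts (chlts_of sg b1 b2 \<alpha>)"
    and rep: "compatible_rep sg b1 b2 \<alpha> sv \<beta> \<theta>1 \<theta>2"
  shows "compatible_hom_lts (chlts_of (prod_scale sg sv)
      (ext_bracket b1 \<theta>1 m1) (ext_bracket b2 \<theta>2 m2) (map_prod \<alpha> \<beta>)) \<longleftrightarrow>
    mixed_rep_identity b1 b2 \<alpha> \<beta> \<theta>1 \<theta>2 \<and> cocycle_pair sg b1 b2 \<alpha> sv \<beta> \<theta>1 \<theta>2 m1 m2"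
proof -
  note r = compatible_repD[OF rep]
  have G1: "type_hom_lts sg b1 \<alpha>" and G2: "type_hom_lts sg b2 \<alpha>"
    and jac: "jacobi_defect b1 b2 \<alpha> a b x y z + jacobi_defect b2 b1 \<alpha> a b x y z = 0" for a b x y z
    using G by (simp_all add: compatible_hom_lts_chlts_of)
  note add1 = hom_lts_repD(2)[OF r(1), THEN linear_add_eq]
  note add2 = hom_lts_repD(2)[OF r(2), THEN linear_add_eq]
  let ?t = "map_prod \<alpha> \<beta>" and ?b1 = "ext_bracket b1 \<theta>1 m1" and ?b2 = "ext_bracket b2 \<theta>2 m2"
  let ?K = "\<lambda>a b x y z. cocycle_defect \<alpha> \<theta>1 m1 b2 m2 a b x y z
        + cocycle_defect \<alpha> \<theta>2 m2 b1 m1 a b x y z"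
  let ?R = "\<lambda>x y a b u. rep_defect2 \<alpha> \<beta> \<theta>1 \<theta>2 b2 x y a b u
    + rep_defect2 \<alpha> \<beta> \<theta>2 \<theta>1 b1 x y a b u"
  let ?S = "\<lambda>x y a b u. rep_defect1 \<alpha> \<beta> \<theta>1 \<theta>2 b2 x y a b u
    + rep_defect1 \<alpha> \<beta> \<theta>2 \<theta>1 b1 x y a b u"
  have defect: "jacobi_defect ?b1 ?b2 ?t (a, ua) (b, ub) (x, ux) (y, uy) (z, uz)
      + jacobi_defect ?b2 ?b1 ?t (a, ua) (b, ub) (x, ux) (y, uy) (z, uz) =
      (0, ?R a b x z uy - ?R a b y z ux + ?R a b x y uz - ?R a b y x uz + ?K a b x y z)"
    (is "?l = _") for a b x y z ua ub ux uy uz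
  proof -
    have "?l = (0, ?S a x y z ub - ?S b x y z ua
        + ?R a b x z uy - ?R a b y z ux + ?R a b x y uz - ?R a b y x uz + ?K a b x y z)"
      unfolding jacobi_defect_ext_bracket[of \<theta>1, OF add1] jacobi_defect_ext_bracket[of \<theta>2, OF add2]
        add_Pair jac by (simp add: algebra_simps)
    \<comment> \<open>The terms \<open>?S\<close>, which carry the vectors of the two outer
      arguments, vanish by \<open>compatible_rep\<close>; the terms \<open>?R\<close>
      remain.\<close>
    then show ?thesis unfolding r(3) by simp
  qed
  have R0: "?R a b x y 0 = 0" for a b x y
    using rep_defect_0(2)[OF r(1,2)] rep_defect_0(2)[OF r(2,1)] by simp
  have jac_iff: "(\<forall>a b x y z. jacobi_defect ?b1 ?b2 ?t a b x y z + jacobi_defect ?b2 ?b1 ?t a b x y z = 0) \<longleftrightarrow>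
    (\<forall>a b x y u. ?R a b x y u = 0) \<and> (\<forall>a b x y z. ?K a b x y z = 0)" (is "?L \<longleftrightarrow> ?A \<and> ?B")
  proof
    assume ?L
    then have *: "?R a b x z uy - ?R a b y z ux + ?R a b x y uz - ?R a b y x uz + ?K a b x y z = 0"
      for a b x y z ux uy uz
      using defect[of a 0 b 0 x ux y uy z uz] by (simp only: zero_prod_def prod.inject) 
    \<comment> \<open>The variables of \<open>*\<close> are instantiated in their order of
      occurrence \<open>a, b, x, z, uy, y, ux, uz\<close>: here all three vectors are zero, and in
      the next step only \<open>uy\<close> is kept.\<close>
    have K: "?K a b x y z = 0" for a b x y z
      using *[of a b x z 0 y 0 0] unfolding R0 by simp
    moreover have "?R a b x y u = 0" for a b x y u
      using *[of a b x y u 0 0 0] unfolding R0 K by simp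
    ultimately show "?A \<and> ?B" by blast
  next
    assume *: "?A \<and> ?B"
    show ?L
    proof (unfold split_paired_All defect, intro allI)
      fix a b x y z uy ux uz
      show "(0, ?R a b x z uy - ?R a b y z ux + ?R a b x y uz - ?R a b y x uz + ?K a b x y z) = 0"
        using * by (simp only: zero_prod_def) simp
    qed
  qed
  show ?thesis
    unfolding compatible_hom_lts_chlts_of type_hom_lts_ext_bracket[OF G1 r(1)]
      type_hom_lts_ext_bracket[OF G2 r(2)] mixed_rep_identity_iff cocycle_pair_def jac_iff
    by blast
qed

section \<open>Cochains of degree one and two as functions, and their coboundaries\<close>

definition cochain1 :: "('g \<Rightarrow> 'v::zero) \<Rightarrow> ('g, 'v) cochain" where
  "cochain1 f As c = (case As of [] \<Rightarrow> f c | _ \<Rightarrow> 0)"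

definition cochain2 :: "('g \<Rightarrow> 'g \<Rightarrow> 'g \<Rightarrow> 'v::zero) \<Rightarrow> ('g, 'v) cochain" where
  "cochain2 m As c = (case As of [(a, b)] \<Rightarrow> m a b c | _ \<Rightarrow> 0)"

lemma cochain1_simps [simp]: "cochain1 f [] c = f c" "cochain1 f (p # As) c = 0"
  by (simp_all add: cochain1_def)

lemma cochain2_simps [simp]:
  "cochain2 m [p] c = m (fst p) (snd p) c" "cochain2 m [] c = 0" "cochain2 m (p # q # As) c = 0"
  by (simp_all add: cochain2_def split: prod.splits)

lemma cochain2_eq_0: "length As \<noteq> 1 \<Longrightarrow> cochain2 m As c = 0"
  by (auto simp: cochain2_def split: list.splits)

lemma cochain1_eq_0: "As \<noteq> [] \<Longrightarrow> cochain1 m As c = 0"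
  by (cases As) auto

lemma cochain2_inject [simp]: "cochain2 m = cochain2 m' \<longleftrightarrow> m = m'"
proof
  assume *: "cochain2 m = cochain2 m'"
  show "m = m'"
  proof (intro ext)
    fix a b c
    show "m a b c = m' a b c" using fun_cong[OF fun_cong[OF *, of "[(a, b)]"], of c] by simp
  qed
qed simp

text \<open>The shapes that the quantifiers in \<open>cochains\<close> take for
  \<open>n = 2\<close>, where \<open>i < n - 1\<close> has become \<open>i = 0\<close>.\<close>

lemma all_length1:
  "(\<forall>As. length As = Suc 0 \<longrightarrow> P As) \<longleftrightarrow> (\<forall>p. P [p])"
  "(\<forall>As c. length As = Suc 0 \<longrightarrow> Q As c) \<longleftrightarrow> (\<forall>p c. Q [p] c)"
  "(\<forall>As i c. length As = Suc 0 \<longrightarrow> i = 0 \<longrightarrow> R As i c) \<longleftrightarrow> (\<forall>p c. R [p] 0 c)"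
  by (auto simp: length_Suc_conv)

lemma cochain2_mem_cochains: "cochain2 m \<in> cochains sg \<alpha> sv \<beta> 2 \<longleftrightarrow> lts_cochain sg \<alpha> sv \<beta> m"
proof -
  have "cochain2 m [p] = m (fst p) (snd p)" for p by (simp add: fun_eq_iff)
  then show ?thesis
    by (simp add: cochains_def lts_cochain_def type_trilinear_def all_length1 cochain2_eq_0) blast
qed

text \<open>A cochain vanishes on lists of the wrong length by definition, just as
  \<open>cochain2\<close> does, so its values on one-pair lists determine it.\<close>

lemma cochains2E:
  assumes "f \<in> cochains sg \<alpha> sv \<beta> 2"
  obtains m where "f = cochain2 m"
proof
  show "f = cochain2 (\<lambda>a b c. f [(a, b)] c)"
  proof (intro ext)
    fix As c
    show "f As c = cochain2 (\<lambda>a b c. f [(a, b)] c) As c"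
      using assms by (cases "length As = 1") (auto simp: cochain2_eq_0 cochains_def length_Suc_conv)
  qed
qed

lemma cochain1_mem_cochains:
  "cochain1 f \<in> cochains sg \<alpha> sv \<beta> 1 \<longleftrightarrow> Vector_Spaces.linear sg sv f \<and> (\<forall>c. \<beta> (f c) = f (\<alpha> c))"
proof -
  have "cochain1 f [] = f" by (simp add: fun_eq_iff)
  then show ?thesis by (auto simp: cochains_def cochain1_eq_0)
qed

lemma cochains1E:
  assumes "f \<in> cochains sg \<alpha> sv \<beta> 1"
  obtains g where "f = cochain1 g"
proof
  show "f = cochain1 (f [])"
  proof (intro ext)
    fix As c
    show "f As c = cochain1 (f []) As c"
      using assms by (cases As) (auto simp: cochains_def)
  qed
qed

text \<open>The coboundary in degree 1, where the double sum is empty. With \<open>\<theta>\<close>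
  read as the action in the semidirect product, it measures how far \<open>f\<close> is from being a
  derivation into \<open>V\<close>.\<close>

definition delta1 where
  "delta1 br \<theta> f a b c = \<theta> b c (f a) - \<theta> a c (f b) + rep_D \<theta> a b (f c) - f (br a b c)"

lemma coboundary_cochain1:
  assumes "vector_space sv"
  shows "coboundary br \<alpha> sv \<theta> 1 (cochain1 f) = cochain2 (delta1 br \<theta> f)"
proof (intro ext)
  fix As c
  interpret vector_space sv by fact
  show "coboundary br \<alpha> sv \<theta> 1 (cochain1 f) As c = cochain2 (delta1 br \<theta> f) As c"
    by (cases "length As = 1")
      (auto simp: coboundary_def cochain2_eq_0 delta1_def omit_def length_Suc_conv)
qed

text \<open>The minus sign comes from \<open>(-1) ^ (i + n)\<close> at \<open>i = 1\<close>,
  \<open>n = 2\<close>: the coboundary gives the action of the first pair the coefficient -1, while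
  in \<open>cocycle_defect\<close> it has +1 as in the fundamental identity.\<close>

lemma coboundary_cochain2:
  assumes "vector_space sv"
  shows "coboundary br \<alpha> sv \<theta> 2 (cochain2 m) As z =
    (case As of [(a, b), (x, y)] \<Rightarrow> - cocycle_defect \<alpha> \<theta> m br m a b x y z | _ \<Rightarrow> 0)"
proof -
  interpret vector_space sv by fact
  show ?thesis
  proof (cases "length As = 2")
    case True
    then obtain a b x y where As: "As = [(a, b), (x, y)]"
      by (auto simp: numeral_2_eq_2 length_Suc_conv)
    have "{Suc 0..2} = {1, 2}" by auto
    then show ?thesis
      by (simp add: As coboundary_def omit_def cocycle_defect_def numeral_2_eq_2 algebra_simps)
  next
    case False
    then show ?thesis
      by (auto simp: coboundary_def split: list.splits)
  qed
qed

section \<open>Cocycles and extensions on the product\<close>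

lemma cochain2_diff:
  "cochain2 m - cochain2 n = cochain2 (\<lambda>a b c. m a b c - n a b (c :: 'g) :: 'v::ab_group_add)"
  by (auto simp: fun_eq_iff cochain2_def split: list.splits)

lemma cocycles_cE:
  assumes "fs \<in> cocycles_c sg b1 b2 \<alpha> sv \<beta> \<theta>1 \<theta>2 2"
  obtains m1 m2 where "fs = [cochain2 m1, cochain2 m2]"
proof -
  obtain f1 f2 where fs: "fs = [f1, f2]" and "f1 \<in> cochains sg \<alpha> sv \<beta> 2" "f2 \<in> cochains sg \<alpha> sv \<beta> 2"
    using assms by (auto simp: cocycles_c_def cochains_c_def numeral_2_eq_2 length_Suc_conv)
  then show thesis using that by (metis cochains2E)
qed

lemma cocycle_defect_eq_0_iff:
  fixes sv :: "'k::field \<Rightarrow> 'v::ab_group_add \<Rightarrow> 'v"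
  assumes "vector_space sv"
  shows "coboundary br \<alpha> sv \<theta> 2 (cochain2 m) = 0 \<longleftrightarrow>
    (\<forall>a b x y z. cocycle_defect \<alpha> \<theta> m br m a b x y z = 0)" (is "?L \<longleftrightarrow> ?R")
proof
  assume ?L
  show ?R
  proof (intro allI)
    fix a b x y z
    show "cocycle_defect \<alpha> \<theta> m br m a b x y z = 0"
      using fun_cong[OF fun_cong[OF \<open>?L\<close>, of "[(a, b), (x, y)]"], of z]
      by (simp add: coboundary_cochain2[OF assms])
  qed
next
  assume ?R
  then show ?L
    by (auto simp: fun_eq_iff coboundary_cochain2[OF assms] split: list.splits)
qed

lemma cocycle_defect_sum_eq_0_iff:
  fixes sv :: "'k::field \<Rightarrow> 'v::ab_group_add \<Rightarrow> 'v"
  assumes "vector_space sv"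
  shows "coboundary b1 \<alpha> sv \<theta>1 2 (cochain2 m2) + coboundary b2 \<alpha> sv \<theta>2 2 (cochain2 m1) = 0 \<longleftrightarrow>
    (\<forall>a b x y z. cocycle_defect \<alpha> \<theta>1 m1 b2 m2 a b x y z + cocycle_defect \<alpha> \<theta>2 m2 b1 m1 a b x y z = 0)"
    (is "?L \<longleftrightarrow> ?R")
proof -
  \<comment> \<open>A defect is a part in the action and inner cochain plus a part in the outer
    cochain and inner bracket. Both sides have the same four parts: \<open>\<theta>1\<close> on
    \<open>m2\<close>, \<open>\<theta>2\<close> on \<open>m1\<close>, \<open>m1\<close> on
    \<open>b2\<close>, \<open>m2\<close> on \<open>b1\<close>.\<close>
  have swap: "cocycle_defect \<alpha> \<theta>1 m2 b1 m2 a b x y z + cocycle_defect \<alpha> \<theta>2 m1 b2 m1 a b x y z =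
    cocycle_defect \<alpha> \<theta>1 m1 b2 m2 a b x y z + cocycle_defect \<alpha> \<theta>2 m2 b1 m1 a b x y z" for a b x y z
    by (simp add: cocycle_defect_def algebra_simps)
  show ?thesis
  proof
    assume ?L
    show ?R
    proof (intro allI)
      fix a b x y z
      have "- cocycle_defect \<alpha> \<theta>1 m2 b1 m2 a b x y z + - cocycle_defect \<alpha> \<theta>2 m1 b2 m1 a b x y z = 0"
        using fun_cong[OF fun_cong[OF \<open>?L\<close>, of "[(a, b), (x, y)]"], of z]
        by (simp add: coboundary_cochain2[OF assms])
      then show "cocycle_defect \<alpha> \<theta>1 m1 b2 m2 a b x y z + cocycle_defect \<alpha> \<theta>2 m2 b1 m1 a b x y z = 0"
        unfolding swap[symmetric] by (metis add.inverse_distrib_swap add.commute neg_equal_0_iff_equal)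
    qed
  next
    assume ?R
    then have "- cocycle_defect \<alpha> \<theta>1 m2 b1 m2 a b x y z - cocycle_defect \<alpha> \<theta>2 m1 b2 m1 a b x y z = 0"
      for a b x y z
      unfolding swap[symmetric]
      by (metis add.inverse_distrib_swap add.commute neg_equal_0_iff_equal add_uminus_conv_diff)
    then show ?L
      by (auto simp: fun_eq_iff coboundary_cochain2[OF assms] split: list.splits)
  qed
qed

lemma mem_cocycles_c_iff:
  fixes sv :: "'k::field \<Rightarrow> 'v::ab_group_add \<Rightarrow> 'v"
  assumes "vector_space sv"
  shows "[cochain2 m1, cochain2 m2] \<in> cocycles_c sg b1 b2 \<alpha> sv \<beta> \<theta>1 \<theta>2 2 \<longleftrightarrow>
    cocycle_pair sg b1 b2 \<alpha> sv \<beta> \<theta>1 \<theta>2 m1 m2"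
proof -
  have "replicate (2 + 1) (0 :: ('a, 'v) cochain) = [0, 0, 0]" by (simp add: numeral_eq_Suc)
  then show ?thesis
    by (auto simp: cocycles_c_def cochains_c_def cochain2_mem_cochains coboundary_c_def
        cocycle_pair_def cocycle_defect_eq_0_iff[OF assms] cocycle_defect_sum_eq_0_iff[OF assms])
qed

lemma mem_cohomologous_iff:
  fixes sv :: "'k::field \<Rightarrow> 'v::ab_group_add \<Rightarrow> 'v"
  assumes "vector_space sv"
  shows "([cochain2 m1, cochain2 m2], [cochain2 n1, cochain2 n2])
      \<in> cohomologous sg b1 b2 \<alpha> sv \<beta> \<theta>1 \<theta>2 2 \<longleftrightarrow>
    cocycle_pair sg b1 b2 \<alpha> sv \<beta> \<theta>1 \<theta>2 m1 m2 \<and> cocycle_pair sg b1 b2 \<alpha> sv \<beta> \<theta>1 \<theta>2 n1 n2 \<and>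
    (\<exists>f. Vector_Spaces.linear sg sv f \<and> (\<forall>c. \<beta> (f c) = f (\<alpha> c)) \<and>
      (\<forall>a b c. m1 a b c - n1 a b c = delta1 b1 \<theta>1 f a b c \<and>
         m2 a b c - n2 a b c = delta1 b2 \<theta>2 f a b c))"
proof -
  have c1: "cochains_c sg \<alpha> sv \<beta> 1 = {[cochain1 f] | f. Vector_Spaces.linear sg sv f \<and> (\<forall>c. \<beta> (f c) = f (\<alpha> c))}"
  proof (intro equalityI subsetI)
    fix fs assume "fs \<in> cochains_c sg \<alpha> sv \<beta> 1"
    then obtain g where g: "fs = [g]" "g \<in> cochains sg \<alpha> sv \<beta> 1"
      by (auto simp: cochains_c_def length_Suc_conv)
    then obtain f where "g = cochain1 f" by (metis cochains1E)
    then show "fs \<in> {[cochain1 f] | f. Vector_Spaces.linear sg sv f \<and> (\<forall>c. \<beta> (f c) = f (\<alpha> c))}"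
      using g by (auto simp: cochain1_mem_cochains[simplified])
  qed (auto simp: cochains_c_def cochain1_mem_cochains[simplified])
  have d: "coboundary_c b1 b2 \<alpha> sv \<theta>1 \<theta>2 1 [cochain1 f] =
      [cochain2 (delta1 b1 \<theta>1 f), cochain2 (delta1 b2 \<theta>2 f)]" for f
    by (simp add: coboundary_c_def coboundary_cochain1[OF assms, simplified])
  have e: "cochain2 m = cochain2 m' \<longleftrightarrow> (\<forall>a b c. m a b c = m' a b c)"
    for m m' :: "'a \<Rightarrow> 'a \<Rightarrow> 'a \<Rightarrow> 'v"
    by (simp only: cochain2_inject) (simp add: fun_eq_iff)
  show ?thesis
    by (auto simp: cohomologous_def mem_cocycles_c_iff[OF assms] c1[simplified] d[simplified]
        cochain2_diff e image_iff Bex_def simp del: cochain2_inject)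
qed

text \<open>The brackets are left arbitrary: a given extension is first moved to the product, and
  only afterwards are its brackets shown to have the form \<open>ext_bracket\<close>.\<close>

definition prod_extension ::
  "('k \<Rightarrow> 'g::ab_group_add \<Rightarrow> 'g) \<Rightarrow> ('k \<Rightarrow> 'v::ab_group_add \<Rightarrow> 'v) \<Rightarrow> ('g \<Rightarrow> 'g) \<Rightarrow> ('v \<Rightarrow> 'v)
    \<Rightarrow> ('g \<times> 'v \<Rightarrow> 'g \<times> 'v \<Rightarrow> 'g \<times> 'v \<Rightarrow> 'g \<times> 'v) \<Rightarrow> ('g \<times> 'v \<Rightarrow> 'g \<times> 'v \<Rightarrow> 'g \<times> 'v \<Rightarrow> 'g \<times> 'v)
    \<Rightarrow> ('k, 'g, 'v, 'g \<times> 'v) extension" where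
  "prod_extension sg sv \<alpha> \<beta> B1 B2 =
     \<lparr>total = chlts_of (prod_scale sg sv) B1 B2 (map_prod \<alpha> \<beta>), incl = Pair 0, proj = fst\<rparr>"

lemma prod_extension_simps [simp]:
  "total (prod_extension sg sv \<alpha> \<beta> B1 B2) = chlts_of (prod_scale sg sv) B1 B2 (map_prod \<alpha> \<beta>)"
  "incl (prod_extension sg sv \<alpha> \<beta> B1 B2) = Pair 0"
  "proj (prod_extension sg sv \<alpha> \<beta> B1 B2) = fst"
  by (simp_all add: prod_extension_def)

lemma type_trilinear_zero:
  assumes "type_trilinear s t m"
  shows "m 0 y z = 0" "m x 0 z = 0" "m x y 0 = 0"
proof -
  have "Vector_Spaces.linear s t (\<lambda>x. m x y z)" "Vector_Spaces.linear s t (\<lambda>y. m x y z)"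
    "Vector_Spaces.linear s t (\<lambda>z. m x y z)"
    using assms by (simp_all add: type_trilinear_def)
  from this[THEN linear_zero_eq] show "m 0 y z = 0" "m x 0 z = 0" "m x y 0 = 0" by simp_all
qed

lemma type_trilinear_add:
  assumes "type_trilinear s t m"
  shows "m (x + x') y z = m x y z + m x' y z" "m x (y + y') z = m x y z + m x y' z"
    "m x y (z + z') = m x y z + m x y z'"
  using assms by (simp_all add: type_trilinear_def linear_iff')

lemma scale_zero:
  assumes "vector_space s"
  shows "s k 0 = 0"
proof -
  interpret vector_space s by fact
  show ?thesis by simp
qed

section \<open>Extensions on the product for a fixed algebra and representation\<close>

locale chlts_rep =
  fixes sg :: "'k::field_char_0 \<Rightarrow> 'g::ab_group_add \<Rightarrow> 'g"
    and b1 b2 :: "'g \<Rightarrow> 'g \<Rightarrow> 'g \<Rightarrow> 'g" and \<alpha> :: "'g \<Rightarrow> 'g"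
    and sv :: "'k \<Rightarrow> 'v::ab_group_add \<Rightarrow> 'v" and \<beta> :: "'v \<Rightarrow> 'v"
    and \<theta>1 \<theta>2 :: "'g \<Rightarrow> 'g \<Rightarrow> 'v \<Rightarrow> 'v"
  assumes compatible_G: "compatible_hom_lts (chlts_of sg b1 b2 \<alpha>)"
    and compatible_rep: "compatible_rep sg b1 b2 \<alpha> sv \<beta> \<theta>1 \<theta>2"
begin

abbreviation "G \<equiv> chlts_of sg b1 b2 \<alpha>"
abbreviation "V \<equiv> trivial_chlts sv \<beta>"
abbreviation "prod_ext m1 m2 \<equiv>
  prod_extension sg sv \<alpha> \<beta> (ext_bracket b1 \<theta>1 m1) (ext_bracket b2 \<theta>2 m2)"

lemmas rep1 = compatible_repD(1)[OF compatible_rep]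
lemmas rep2 = compatible_repD(2)[OF compatible_rep]
lemmas theta_add = rep1[THEN hom_lts_repD(2), THEN linear_add_eq]
  rep1[THEN hom_lts_repD(3), THEN linear_add_eq] rep1[THEN hom_lts_repD(4), THEN linear_add_eq]
  rep2[THEN hom_lts_repD(2), THEN linear_add_eq]
  rep2[THEN hom_lts_repD(3), THEN linear_add_eq] rep2[THEN hom_lts_repD(4), THEN linear_add_eq]
lemmas theta_zero = rep1[THEN hom_lts_repD(2), THEN linear_zero_eq]
  rep1[THEN hom_lts_repD(3), THEN linear_zero_eq] rep1[THEN hom_lts_repD(4), THEN linear_zero_eq]
  rep2[THEN hom_lts_repD(2), THEN linear_zero_eq]
  rep2[THEN hom_lts_repD(3), THEN linear_zero_eq] rep2[THEN hom_lts_repD(4), THEN linear_zero_eq]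
lemmas linear_beta = rep1[THEN hom_lts_repD(1)]

lemma vector_spaces: "vector_space sg" "vector_space sv" "vector_space (prod_scale sg sv)"
proof -
  show *: "vector_space sg" "vector_space sv"
    using compatible_G linear_beta
    by (simp_all add: compatible_hom_lts_chlts_of type_hom_lts_def linear_iff')
  show "vector_space (prod_scale sg sv)"
    by (rule vector_space_prod_scale[OF *])
qed

lemma bracket_zero: "b1 0 y z = 0" "b1 x 0 z = 0" "b1 x y 0 = 0"
  "b2 0 y z = 0" "b2 x 0 z = 0" "b2 x y 0 = 0"
  using compatible_G
  by (simp_all add: compatible_hom_lts_chlts_of type_hom_lts_def type_trilinear_zero[of sg sg])

lemma linear_alpha: "Vector_Spaces.linear sg sg \<alpha>"
  using compatible_G by (simp add: compatible_hom_lts_chlts_of type_hom_lts_def)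

lemma linear_Pair_0: "Vector_Spaces.linear sg (prod_scale sg sv) (\<lambda>a. (a, 0))"
  "Vector_Spaces.linear sv (prod_scale sg sv) (Pair 0)"
  using vector_spaces scale_zero[OF vector_spaces(1)]
    scale_zero[OF vector_spaces(2)]
  by (simp_all add: linear_iff' prod_scale_def)

text \<open>The projection is \<open>fst\<close>, so sections are graphs. Thereby
  \<open>induces\<close> becomes an identity over all linear maps \<open>f\<close>, the form in
  which \<open>eq_ext_bracket\<close> uses it.\<close>

lemma is_section_prod_ext_iff:
  "is_section G (prod_extension sg sv \<alpha> \<beta> B1 B2) \<sigma> \<longleftrightarrow>
     (\<exists>f. Vector_Spaces.linear sg sv f \<and> \<sigma> = (\<lambda>a. (a, f a)))" (is "?L \<longleftrightarrow> ?R")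
proof
  assume ?L
  then have *: "fst (\<sigma> a) = a" "Vector_Spaces.linear sg (prod_scale sg sv) \<sigma>" for a
    by (simp_all add: is_section_def vs_hom_chlts_of vector_spaces)
  then have "\<sigma> = (\<lambda>a. (a, snd (\<sigma> a)))" by (metis prod.collapse)
  moreover have "Vector_Spaces.linear sg sv (\<lambda>a. snd (\<sigma> a))"
    using *(2) vector_spaces by (simp add: linear_iff' prod_scale_def)
  ultimately show ?R by blast
next
  assume ?R
  then show ?L
    using vector_spaces
    by (auto simp: is_section_def vs_hom_chlts_of linear_iff' prod_scale_def)
qed

lemma is_hom_section_Pair_0: "is_hom_section G (prod_extension sg sv \<alpha> \<beta> B1 B2) (\<lambda>a. (a, 0))"
  using linear_zero_eq[OF linear_beta] vector_spaces linear_Pair_0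
  by (auto simp: is_hom_section_def is_section_def vs_hom_chlts_of)

lemma section_cocycle_prod_ext:
  "section_cocycle G (prod_ext m1 m2) (\<lambda>a. (a, 0)) = [cochain2 m1, cochain2 m2]"
proof -
  have "the_inv (Pair (0::'g)) (0, u) = u" for u :: 'v
    by (rule the_inv_f_f) (simp add: inj_def)
  then have "section_cochain (prod_ext m1 m2) (ext_bracket br \<theta> m) br (\<lambda>a. (a, 0)) = cochain2 m"
    if "\<And>x y. \<theta> x y 0 = 0" for br \<theta> m
    using that
    by (auto simp: section_cochain_def cochain2_def fun_eq_iff rep_D_def split: list.splits)
  then show ?thesis
    by (simp add: section_cocycle_def theta_zero)
qed

text \<open>Apart from compatibility, which \<open>compatible_hom_lts_ext_bracket\<close> settles,
  the remaining conditions follow from multilinearity: terms with 0 as an argument of the bracket,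
  the action or the cochain vanish.\<close>

lemma prod_ext_mem_iff:
  "prod_ext m1 m2 \<in> extensions_inducing G V \<theta>1 \<theta>2 \<longleftrightarrow>
     mixed_rep_identity b1 b2 \<alpha> \<beta> \<theta>1 \<theta>2 \<and> cocycle_pair sg b1 b2 \<alpha> sv \<beta> \<theta>1 \<theta>2 m1 m2"
  (is "?L \<longleftrightarrow> ?R")
proof
  assume ?L
  then show ?R
    unfolding compatible_hom_lts_ext_bracket[OF compatible_G compatible_rep, symmetric]
    by (simp add: extensions_inducing_def abelian_extension_simps)
next
  assume R: ?R
  then have c: "compatible_hom_lts (total (prod_ext m1 m2))"
    unfolding compatible_hom_lts_ext_bracket[OF compatible_G compatible_rep, symmetric] by simp
  have "type_trilinear sg sv m1" "type_trilinear sg sv m2"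
    using R by (simp_all add: cocycle_pair_def lts_cochain_def)
  note m = this[THEN type_trilinear_zero(1)] this[THEN type_trilinear_zero(2)]
  have incl: "chlts_hom V (total (prod_ext m1 m2)) (Pair 0)"
    using vector_spaces linear_Pair_0(2) linear_zero_eq[OF linear_alpha]
    by (simp add: chlts_hom_def vs_hom_chlts_of bracket_zero theta_zero rep_D_def m zero_prod_def)
  have proj: "chlts_hom (total (prod_ext m1 m2)) G fst"
    using vector_spaces
    by (auto simp: chlts_hom_def vs_hom_chlts_of linear_iff' prod_scale_def)
  have "abelian_extension G V (prod_ext m1 m2)"
    unfolding abelian_extension_simps using c incl proj
    by (auto simp: inj_def bracket_zero theta_zero rep_D_def m zero_prod_def image_iff)
  moreover have "induces G V (prod_ext m1 m2) \<theta>1 \<theta>2"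
    \<comment> \<open>For the section given by \<open>f\<close>, the terms with \<open>f a\<close>
      and \<open>f b\<close> are acted on through pairs containing 0, the algebra component of the
      element of \<open>V\<close>, so only \<open>\<theta> a b u\<close> survives for each of the
      two actions.\<close>
    by (auto simp: induces_def is_section_prod_ext_iff bracket_zero theta_zero rep_D_def m)
  ultimately show ?L
    using is_hom_section_Pair_0 by (auto simp: extensions_inducing_def)
qed

lemma ext_iso_prod_ext_iff:
  "(\<exists>\<zeta>. ext_iso V (prod_ext m1 m2) (prod_ext n1 n2) \<zeta>) \<longleftrightarrow>
    (\<exists>f. Vector_Spaces.linear sg sv f \<and> (\<forall>c. \<beta> (f c) = f (\<alpha> c)) \<and>
      (\<forall>a b c. m1 a b c - n1 a b c = delta1 b1 \<theta>1 f a b c \<and>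
         m2 a b c - n2 a b c = delta1 b2 \<theta>2 f a b c))" (is "?L \<longleftrightarrow> ?R")
proof
  assume ?L
  then obtain \<zeta> where \<zeta>: "ext_iso V (prod_ext m1 m2) (prod_ext n1 n2) \<zeta>" by blast
  then have lin: "Vector_Spaces.linear (prod_scale sg sv) (prod_scale sg sv) \<zeta>"
    and inc: "\<zeta> (0, u) = (0, u)" and pr: "fst (\<zeta> x) = fst x"
    and tw: "\<zeta> (map_prod \<alpha> \<beta> x) = map_prod \<alpha> \<beta> (\<zeta> x)"
    and br: "\<zeta> (ext_bracket b1 \<theta>1 m1 x y z) = ext_bracket b1 \<theta>1 n1 (\<zeta> x) (\<zeta> y) (\<zeta> z)"
      "\<zeta> (ext_bracket b2 \<theta>2 m2 x y z) = ext_bracket b2 \<theta>2 n2 (\<zeta> x) (\<zeta> y) (\<zeta> z)" for u x y z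
    by (simp_all add: ext_iso_def chlts_iso_def chlts_hom_def vs_hom_chlts_of vector_spaces
        del: split_paired_All)
  \<comment> \<open>As \<open>\<zeta>\<close> fixes \<open>V\<close> and respects the projections,
    its values on the zero section determine it.\<close>
  define f where "f a = snd (\<zeta> (a, 0))" for a
  have \<zeta>_eq: "\<zeta> (a, u) = (a, u + f a)" for a u
    using linear_add_eq[OF lin, of "(a, 0)" "(0, u)"] pr[of "(a, 0)"]
    by (simp add: inc prod_eq_iff f_def add.commute)
  have "Vector_Spaces.linear sg sv f"
    unfolding linear_iff'
  proof (intro conjI allI vector_spaces)
    fix x y k
    show "f (x + y) = f x + f y"
      using linear_add_eq[OF lin, of "(x, 0)" "(y, 0)"] by (simp add: f_def)
    show "f (sg k x) = sv k (f x)"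
      using linear_scale_eq[OF lin, of k "(x, 0)"] scale_zero[OF vector_spaces(2)]
      by (simp add: f_def prod_scale_def)
  qed
  moreover have "\<beta> (f c) = f (\<alpha> c)" for c
    using tw[of "(c, 0)"] linear_zero_eq[OF linear_beta] by (simp add: \<zeta>_eq)
  moreover have "m1 a b c - n1 a b c = delta1 b1 \<theta>1 f a b c \<and>
         m2 a b c - n2 a b c = delta1 b2 \<theta>2 f a b c" for a b c
    using br[of "(a, 0)" "(b, 0)" "(c, 0)"]
    by (simp add: \<zeta>_eq delta1_def theta_zero rep_D_def algebra_simps)
  ultimately show ?R by blast
next
  assume ?R
  then obtain f where lin: "Vector_Spaces.linear sg sv f" and eq: "\<And>c. \<beta> (f c) = f (\<alpha> c)"
    and m: "\<And>a b c. m1 a b c = n1 a b c + delta1 b1 \<theta>1 f a b c"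
      "\<And>a b c. m2 a b c = n2 a b c + delta1 b2 \<theta>2 f a b c"
    by (auto simp: diff_eq_eq add.commute)
  define \<zeta> where "\<zeta> = (\<lambda>(a, u). (a, u + f a))"
  have "bij \<zeta>"
    by (rule bij_betw_byWitness[where f' = "\<lambda>(a, u). (a, u - f a)"]) (auto simp: \<zeta>_def)
  moreover have "Vector_Spaces.linear (prod_scale sg sv) (prod_scale sg sv) \<zeta>"
    using lin vector_spaces
    by (auto simp: linear_iff' prod_scale_def \<zeta>_def algebra_simps
        vector_space.vector_space_assms(1)[OF vector_spaces(2)])
  ultimately have "ext_iso V (prod_ext m1 m2) (prod_ext n1 n2) \<zeta>"
    unfolding ext_iso_def chlts_iso_def chlts_hom_def
    using linear_zero_eq[OF lin] linear_add_eq[OF linear_beta]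
    by (auto simp: vs_hom_chlts_of vector_spaces \<zeta>_def eq m delta1_def rep_D_def theta_add algebra_simps)
  then show ?L by blast
qed

end

section \<open>Normal form of an extension\<close>

text \<open>Extend \<open>{a}\<close> to a basis. This supplies a section through any prescribed
  lift of a nonzero \<open>a\<close>, so that independence of the section can be exploited.\<close>

lemma exists_linear_value:
  assumes "vector_space sg" "vector_space sv" "a \<noteq> 0"
  shows "\<exists>f. Vector_Spaces.linear sg sv f \<and> f a = w"
proof -
  interpret vector_space_pair sg sv
    using assms by (simp add: vector_space_pair_def)
  have "vs1.independent {a}" using assms(3) by simp
  from linear_independent_extend[OF this, of "\<lambda>_. w"] show ?thesis by auto
qed

text \<open>
  The last hypothesis expresses that \<open>\<theta>\<close> is independent of the section. Comparing \<open>f\<close> with \<open>0\<close>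
  at \<open>b = a\<close> gives \<open>B (0, u) (a, 0) (0, f a) = 0\<close>, which \<open>abel\<close> does not provide.
\<close>

lemma eq_ext_bracket:
  fixes sg :: "'k::field \<Rightarrow> 'g::ab_group_add \<Rightarrow> 'g" and sv :: "'k \<Rightarrow> 'v::ab_group_add \<Rightarrow> 'v"
  assumes vs: "vector_space sg" "vector_space sv"
    and tri: "type_trilinear (prod_scale sg sv) (prod_scale sg sv) B"
    and skew: "\<And>x y z. B x y z + B y x z = 0"
    and cyc: "\<And>x y z. B x y z + B z x y + B y z x = 0"
    and proj: "\<And>x y z. fst (B x y z) = br (fst x) (fst y) (fst z)"
    and abel: "\<And>u v x. B (0, u) (0, v) x = 0"
    and ind: "\<And>f u a b. Vector_Spaces.linear sg sv f \<Longrightarrow> B (0, u) (a, f a) (b, f b) = (0, \<theta> a b u)"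
  shows "B = ext_bracket br \<theta> (\<lambda>a b c. snd (B (a, 0) (b, 0) (c, 0)))"
proof -
  note add = type_trilinear_add[OF tri]
  have uaa: "B (0, u) (a, 0) (b, 0) = (0, \<theta> a b u)" for a b u
    using ind[of "\<lambda>_. 0"] vs by (simp add: linear_iff' scale_zero)
  have uau: "B (0, u) (a, 0) (0, w) = 0" for a u w
  proof (cases "a = 0")
    case True
    then show ?thesis using abel by simp
  next
    case False
    then obtain f where f: "Vector_Spaces.linear sg sv f" "f a = w"
      using exists_linear_value[OF vs] by blast
    have "B (0, u) (a, 0) (a, 0) = B (0, u) ((a, 0) + (0, w)) ((a, 0) + (0, w))"
      using ind[OF f(1), of u a a] f(2) uaa by simp
    also have "\<dots> = B (0, u) (a, 0) (a, 0) + B (0, u) (a, 0) (0, w)"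
      unfolding add abel by simp
    finally show ?thesis by simp
  qed
  have swap: "B x y z = - B y x z" for x y z
    using skew[of x y z] by (simp add: eq_neg_iff_add_eq_0)
  have auu: "B (a, 0) (0, u) (0, w) = 0" for a u w
    using swap[of "(a, 0)" "(0, u)"] uau by simp
  have aua: "B (a, 0) (0, u) (c, 0) = (0, - \<theta> a c u)" for a u c
    using swap[of "(a, 0)" "(0, u)"] uaa by simp
  \<comment> \<open>The cyclic identity moves the vector from the third slot to the first two, where
    the action is known.\<close>
  have aau: "B (a, 0) (b, 0) (0, w) = (0, rep_D \<theta> a b w)" for a b w
  proof -
    have "B (a, 0) (b, 0) (0, w) = - (B (0, w) (a, 0) (b, 0) + B (b, 0) (0, w) (a, 0))"
      using cyc[of "(a, 0)" "(b, 0)" "(0, w)"] unfolding eq_neg_iff_add_eq_0 add.assoc .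
    then show ?thesis by (simp add: uaa aua rep_D_def)
  qed
  show ?thesis
  proof (intro ext)
    fix p q r :: "'g \<times> 'v"
    obtain a u b v c w where p: "p = (a, 0) + (0, u)" and q: "q = (b, 0) + (0, v)"
      and r: "r = (c, 0) + (0, w)"
      by (rule that[of "fst p" "snd p" "fst q" "snd q" "fst r" "snd r"]) simp_all
    \<comment> \<open>Of the eight terms of the expansion, those with at least two arguments from
      \<open>V\<close> vanish.\<close>
    have "B p q r = B (a, 0) (b, 0) (c, 0) + (0, rep_D \<theta> a b w) + (0, - \<theta> a c v) + (0, \<theta> b c u)"
      unfolding p q r add abel uau auu aua uaa aau by (simp add: algebra_simps)
    moreover have "B (a, 0) (b, 0) (c, 0) = (br a b c, snd (B (a, 0) (b, 0) (c, 0)))"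
      using proj[of "(a, 0)" "(b, 0)" "(c, 0)"] by (simp add: prod_eq_iff)
    ultimately show "B p q r = ext_bracket br \<theta> (\<lambda>a b c. snd (B (a, 0) (b, 0) (c, 0))) p q r"
      unfolding p q r by (simp add: prod_eq_iff)
  qed
qed

section \<open>Reduction of an arbitrary extension to the product\<close>

lemma ext_isoD:
  assumes "ext_iso V E E' f"
  shows "chlts_hom (total E) (total E') f" "vs_hom (total E) (total E') f"
    "bij_betw f (carrier (total E)) (carrier (total E'))"
    "u \<in> carrier V \<Longrightarrow> f (incl E u) = incl E' u"
    "x \<in> carrier (total E) \<Longrightarrow> proj E' (f x) = proj E x"
  using assms by (simp_all add: ext_iso_def chlts_iso_def chlts_hom_def)

lemma chlts_homD:
  assumes "chlts_hom L M f"
  shows "vs_hom L M f" "x \<in> carrier L \<Longrightarrow> f (twist L x) = twist M (f x)"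
    "x \<in> carrier L \<Longrightarrow> y \<in> carrier L \<Longrightarrow> z \<in> carrier L \<Longrightarrow>
       f (bracket1 L x y z) = bracket1 M (f x) (f y) (f z)"
    "x \<in> carrier L \<Longrightarrow> y \<in> carrier L \<Longrightarrow> z \<in> carrier L \<Longrightarrow>
       f (bracket2 L x y z) = bracket2 M (f x) (f y) (f z)"
  using assms by (simp_all add: chlts_hom_def)

context chlts_rep
begin

lemma abelian_extensionD:
  assumes "abelian_extension G V E"
  shows "compatible_hom_lts (total E)" "chlts_hom V (total E) (incl E)"
    "chlts_hom (total E) G (proj E)" "inj (incl E)"
    "\<And>u. incl E u \<in> carrier (total E)" "\<And>u. proj E (incl E u) = 0"
    "\<And>x. x \<in> carrier (total E) \<Longrightarrow> proj E x = 0 \<Longrightarrow> \<exists>u. x = incl E u"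
    "\<And>u v x. x \<in> carrier (total E) \<Longrightarrow> bracket1 (total E) (incl E u) (incl E v) x = \<zero>\<^bsub>total E\<^esub>"
    "\<And>u v x. x \<in> carrier (total E) \<Longrightarrow> bracket2 (total E) (incl E u) (incl E v) x = \<zero>\<^bsub>total E\<^esub>"
proof -
  have ker: "range (incl E) = {x \<in> carrier (total E). proj E x = 0}"
    using assms by (simp add: abelian_extension_simps)
  show "compatible_hom_lts (total E)" "chlts_hom V (total E) (incl E)"
    "chlts_hom (total E) G (proj E)" "inj (incl E)"
    "\<And>u v x. x \<in> carrier (total E) \<Longrightarrow> bracket1 (total E) (incl E u) (incl E v) x = \<zero>\<^bsub>total E\<^esub>"
    "\<And>u v x. x \<in> carrier (total E) \<Longrightarrow> bracket2 (total E) (incl E u) (incl E v) x = \<zero>\<^bsub>total E\<^esub>"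
    using assms by (simp_all add: abelian_extension_simps)
  show "incl E u \<in> carrier (total E)" "proj E (incl E u) = 0" for u
    using ker by blast+
  show "\<exists>u. x = incl E u" if "x \<in> carrier (total E)" "proj E x = 0" for x
    using ker that by blast
qed

lemma extensions_inducing_transport:
  assumes E: "E \<in> extensions_inducing G V \<theta>1 \<theta>2" and f: "ext_iso V E E' f"
    and z: "f \<zero>\<^bsub>total E\<^esub> = \<zero>\<^bsub>total E'\<^esub>"
  shows "E' \<in> extensions_inducing G V \<theta>1 \<theta>2"
    and "is_hom_section G E \<sigma> \<Longrightarrow> is_hom_section G E' (f \<circ> \<sigma>)"
proof -
  note D = ext_isoD[OF f]
  have ab: "abelian_extension G V E" and ind: "induces G V E \<theta>1 \<theta>2"
    using E by (simp_all add: extensions_inducing_def)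
  show sec: "is_hom_section G E' (f \<circ> \<sigma>)" if "is_hom_section G E \<sigma>" for \<sigma>
    using that D(1,5) vs_hom_comp[OF _ D(2), of G \<sigma>] vs_hom_closed[of G "total E" \<sigma>]
    by (auto simp: is_hom_section_def is_section_def chlts_homD)
  let ?g = "inv_into (carrier (total E)) f"
  have inv: "ext_iso V E' E ?g" by (rule ext_iso_inv[OF ab f])
  have "induces G V E' \<theta>1 \<theta>2"
    unfolding induces_def
  proof (intro allI impI ballI)
    fix \<sigma> a b u assume \<sigma>: "is_section G E' \<sigma>"
    have cl: "\<sigma> c \<in> carrier (total E')" for c
      using \<sigma> vs_hom_closed[of G "total E'" \<sigma> c] by (simp add: is_section_def)
    have gs: "?g (\<sigma> c) \<in> carrier (total E)" for c
      using vs_hom_closed[OF ext_isoD(2)[OF inv] cl] .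
    have fg: "f (?g (\<sigma> c)) = \<sigma> c" for c
      using cl bij_betw_imp_surj_on[OF D(3)] by (simp add: f_inv_into_f)
    \<comment> \<open>Since \<open>induces\<close> ranges over all sections of \<open>E'\<close>,
      each of them is pulled back to a section of \<open>E\<close>.\<close>
    have "is_section G E (?g \<circ> \<sigma>)"
      using \<sigma> vs_hom_comp[OF _ ext_isoD(2)[OF inv], of G \<sigma>] ext_isoD(5)[OF inv cl]
      by (simp add: is_section_def)
    then have "incl E (\<theta>1 a b u) = bracket1 (total E) (incl E u) (?g (\<sigma> a)) (?g (\<sigma> b))"
      "incl E (\<theta>2 a b u) = bracket2 (total E) (incl E u) (?g (\<sigma> a)) (?g (\<sigma> b))"
      using ind by (auto simp: induces_def)
    from this[THEN arg_cong[of _ _ f]]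
    show "incl E' (\<theta>1 a b u) = bracket1 (total E') (incl E' u) (\<sigma> a) (\<sigma> b) \<and>
      incl E' (\<theta>2 a b u) = bracket2 (total E') (incl E' u) (\<sigma> a) (\<sigma> b)"
      by (simp add: chlts_homD(3,4)[OF D(1)] D(4) fg gs abelian_extensionD(5)[OF ab])
  qed
  moreover have "abelian_extension G V E'"
    by (rule abelian_extension_transport[OF ab f z refl])
  ultimately show "E' \<in> extensions_inducing G V \<theta>1 \<theta>2"
    using E sec by (auto simp: extensions_inducing_def)
qed

lemma section_cocycle_transport:
  assumes E: "E \<in> extensions_inducing G V \<theta>1 \<theta>2" and f: "ext_iso V E E' f"
    and z: "f \<zero>\<^bsub>total E\<^esub> = \<zero>\<^bsub>total E'\<^esub>" and \<sigma>: "is_section G E \<sigma>"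
  shows "section_cocycle G E' (f \<circ> \<sigma>) = section_cocycle G E \<sigma>"
proof -
  note D = ext_isoD[OF f]
  have ab: "abelian_extension G V E"
    using E by (simp add: extensions_inducing_def)
  have ab': "abelian_extension G V E'"
    using extensions_inducing_transport(1)[OF E f z] by (simp add: extensions_inducing_def)
  note A = abelian_extensionD[OF ab] and A' = abelian_extensionD[OF ab']
  note gr = A(1)[THEN compatible_hom_lts_abelian_group] A'(1)[THEN compatible_hom_lts_abelian_group]
  interpret L: abelian_group "total E" by (rule gr)
  have cl: "\<sigma> c \<in> carrier (total E)" for c
    using \<sigma> vs_hom_closed[of G "total E" \<sigma> c] by (simp add: is_section_def)
  have ps: "proj E (\<sigma> c) = c" for c using \<sigma> by (simp add: is_section_def)
  \<comment> \<open>Equal projections put the differences in the images of the inclusions, where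
    \<open>the_inv\<close> is a genuine inverse.\<close>
  have *: "the_inv (incl E') (f x \<ominus>\<^bsub>total E'\<^esub> f y) = the_inv (incl E) (x \<ominus>\<^bsub>total E\<^esub> y)"
    if xy: "x \<in> carrier (total E)" "y \<in> carrier (total E)" "proj E x = proj E y" for x y
  proof -
    have "proj E (x \<ominus>\<^bsub>total E\<^esub> y) = 0"
      using vs_hom_minus[OF chlts_homD(1)[OF A(3)] gr(1) _ xy(1,2)] xy(3) by simp
    then obtain u where u: "x \<ominus>\<^bsub>total E\<^esub> y = incl E u"
      using A(7) xy(1,2) L.minus_closed by blast
    have "f x \<ominus>\<^bsub>total E'\<^esub> f y = incl E' u"
      using vs_hom_minus[OF D(2) gr xy(1,2)] u D(4) by simp
    then show ?thesis
      using u the_inv_f_f[OF A(4)] the_inv_f_f[OF A'(4)] by simp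
  qed
  have "section_cochain E' (bracket1 (total E')) b1 (f \<circ> \<sigma>) As c =
      section_cochain E (bracket1 (total E)) b1 \<sigma> As c" for As c
    unfolding section_cochain_def
    by (auto split: list.splits simp: chlts_homD(3)[OF D(1), symmetric] chlts_homD(3)[OF A(3)] cl ps *
      compatible_hom_lts_closed[OF A(1)])
  moreover have "section_cochain E' (bracket2 (total E')) b2 (f \<circ> \<sigma>) As c =
      section_cochain E (bracket2 (total E)) b2 \<sigma> As c" for As c
    unfolding section_cochain_def
    by (auto split: list.splits simp: chlts_homD(4)[OF D(1), symmetric] chlts_homD(4)[OF A(3)] cl ps *
      compatible_hom_lts_closed[OF A(1)])
  ultimately show ?thesis
    by (simp add: section_cocycle_def fun_eq_iff)
qed

text \<open>The map \<open>(a, u) \<mapsto> \<sigma> a + incl E u\<close> is a linear bijection,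
  because \<open>x\<close> minus the lift of its projection lies in the kernel. The product receives
  the brackets that make its inverse a homomorphism.\<close>

lemma ext_iso_prod_extension:
  assumes E: "E \<in> extensions_inducing G V \<theta>1 \<theta>2" and \<sigma>: "is_hom_section G E \<sigma>"
  shows "\<exists>B1 B2 f. ext_iso V E (prod_extension sg sv \<alpha> \<beta> B1 B2) f \<and> (\<forall>a. f (\<sigma> a) = (a, 0))"
proof -
  have ab: "abelian_extension G V E" using E by (simp add: extensions_inducing_def)
  note A = abelian_extensionD[OF ab]
  let ?L = "total E"
  interpret L: abelian_group ?L by (rule A(1)[THEN compatible_hom_lts_abelian_group])
  interpret M: Module.module "ring_of_type_algebra :: 'k ring" ?L
    by (rule hom_ltsD(1)[OF compatible_hom_ltsD(1)[OF A(1)]])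
  note iv = chlts_homD(1)[OF A(2)] and pv = chlts_homD(1)[OF A(3)]
  have sv: "vs_hom G ?L \<sigma>" and ps: "proj E (\<sigma> c) = c" and st: "\<sigma> (\<alpha> c) = twist ?L (\<sigma> c)" for c
    using \<sigma> by (auto simp: is_hom_section_def is_section_def)
  have scl [simp]: "\<sigma> c \<in> carrier ?L" for c
    using vs_hom_closed[OF sv, of c] by simp
  note [simp] = A(5) compatible_hom_lts_closed(4)[OF A(1)] A(6) ps
  define g where "g = (\<lambda>(a, u). \<sigma> a \<oplus>\<^bsub>?L\<^esub> incl E u)"
  have g_cl [simp]: "g p \<in> carrier ?L" for p
    by (cases p) (simp add: g_def)
  have pg: "proj E (g p) = fst p" for p
    using vs_hom_add[OF pv, of "\<sigma> (fst p)" "incl E (snd p)"] by (simp add: g_def split_beta)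
  have z: "\<sigma> 0 = \<zero>\<^bsub>?L\<^esub>" "incl E 0 = \<zero>\<^bsub>?L\<^esub>"
    using vs_hom_zero[OF sv] vs_hom_zero[OF iv] L.abelian_group_axioms by simp_all
  have g0: "g (a, 0) = \<sigma> a" "g (0, u) = incl E u" for a u
    by (simp_all add: g_def z)
  have g_add: "g (p + q) = g p \<oplus>\<^bsub>?L\<^esub> g q" for p q
    using vs_hom_add[OF sv, of "fst p" "fst q"] vs_hom_add[OF iv, of "snd p" "snd q"]
    by (simp add: g_def split_beta L.a_ac)
  have g_sc: "g (prod_scale sg sv k p) = k \<odot>\<^bsub>?L\<^esub> g p" for k p
    using vs_hom_smult[OF sv, of "fst p" k] vs_hom_smult[OF iv, of "snd p" k]
      M.smult_r_distr[of k "\<sigma> (fst p)" "incl E (snd p)"]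
    by (simp add: g_def split_beta prod_scale_def)
  \<comment> \<open>Here the section has to commute with the twists; a merely linear section would
    not yield the twist \<open>map_prod \<alpha> \<beta>\<close> in general.\<close>
  have g_tw: "g (map_prod \<alpha> \<beta> p) = twist ?L (g p)" for p
    using vs_hom_add[OF hom_ltsD(3)[OF compatible_hom_ltsD(1)[OF A(1)]], of "\<sigma> (fst p)" "incl E (snd p)"]
      chlts_homD(2)[OF A(2), of "snd p"]
    by (simp add: g_def split_beta st)
  have inj: "inj g"
  proof (rule injI)
    fix p q assume eq: "g p = g q"
    then have "fst p = fst q" using pg by metis
    moreover from this eq have "incl E (snd p) = incl E (snd q)"
      by (simp add: g_def split_beta)
    ultimately show "p = q" using A(4) by (simp add: prod_eq_iff inj_eq)
  qed
  have "\<exists>p. x = g p" if x: "x \<in> carrier ?L" for x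
  proof -
    have "proj E (x \<ominus>\<^bsub>?L\<^esub> \<sigma> (proj E x)) = 0"
      using vs_hom_minus[OF pv _ _ x, of "\<sigma> (proj E x)"] L.abelian_group_axioms by simp
    then obtain u where "x \<ominus>\<^bsub>?L\<^esub> \<sigma> (proj E x) = incl E u"
      using A(7) x by (meson L.minus_closed scl)
    moreover have "x = \<sigma> (proj E x) \<oplus>\<^bsub>?L\<^esub> (x \<ominus>\<^bsub>?L\<^esub> \<sigma> (proj E x))"
      using x by (simp add: L.minus_eq L.a_ac L.r_neg)
    ultimately have "x = g (proj E x, u)" by (simp add: g_def)
    then show ?thesis by blast
  qed
  then have im: "carrier ?L = range g" by auto
  define f where "f = inv_into UNIV g"
  have fg [simp]: "f (g p) = p" for p unfolding f_def using inj by simp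
  define B1 where "B1 = (\<lambda>p q r. f (bracket1 ?L (g p) (g q) (g r)))"
  define B2 where "B2 = (\<lambda>p q r. f (bracket2 ?L (g p) (g q) (g r)))"
  have "bij_betw f (carrier ?L) UNIV"
    unfolding im f_def using inj by (simp add: bij_betw_inv_into inj_on_imp_bij_betw)
  moreover have "chlts_hom ?L (chlts_of (prod_scale sg sv) B1 B2 (map_prod \<alpha> \<beta>)) f"
    unfolding chlts_hom_def vs_hom_def im
    by (simp add: B1_def B2_def g_add[symmetric] g_sc[symmetric] g_tw[symmetric])
  ultimately have "ext_iso V E (prod_extension sg sv \<alpha> \<beta> B1 B2) f"
    unfolding ext_iso_def chlts_iso_def by (auto simp: im pg g0(2)[symmetric])
  moreover have "f (\<sigma> a) = (a, 0)" for a
    by (simp add: g0(1)[symmetric])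
  ultimately show ?thesis by blast
qed

lemma prod_extension_eq_prod_ext:
  assumes "prod_extension sg sv \<alpha> \<beta> B1 B2 \<in> extensions_inducing G V \<theta>1 \<theta>2"
  shows "\<exists>m1 m2. prod_extension sg sv \<alpha> \<beta> B1 B2 = prod_ext m1 m2"
proof -
  let ?P = "prod_extension sg sv \<alpha> \<beta> B1 B2"
  have ab: "abelian_extension G V ?P" and ind: "induces G V ?P \<theta>1 \<theta>2"
    using assms by (simp_all add: extensions_inducing_def)
  note A = abelian_extensionD[OF ab]
  have h: "type_hom_lts (prod_scale sg sv) B1 (map_prod \<alpha> \<beta>)"
    "type_hom_lts (prod_scale sg sv) B2 (map_prod \<alpha> \<beta>)"
    using A(1) by (simp_all add: compatible_hom_lts_chlts_of)
  have ind': "B1 (0, u) (a, f a) (b, f b) = (0, \<theta>1 a b u)" "B2 (0, u) (a, f a) (b, f b) = (0, \<theta>2 a b u)"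
    if "Vector_Spaces.linear sg sv f" for f a b u
    using ind that by (auto simp: induces_def is_section_prod_ext_iff)
  have "B1 = ext_bracket b1 \<theta>1 (\<lambda>a b c. snd (B1 (a, 0) (b, 0) (c, 0)))"
    by (rule eq_ext_bracket[OF vector_spaces(1,2)])
      (use h(1) A(8) ind'(1) chlts_homD(3)[OF A(3)] in \<open>simp_all add: type_hom_lts_def del: split_paired_All\<close>)
  moreover have "B2 = ext_bracket b2 \<theta>2 (\<lambda>a b c. snd (B2 (a, 0) (b, 0) (c, 0)))"
    by (rule eq_ext_bracket[OF vector_spaces(1,2)])
      (use h(2) A(9) ind'(2) chlts_homD(4)[OF A(3)] in \<open>simp_all add: type_hom_lts_def del: split_paired_All\<close>)
  ultimately show ?thesis by metis
qed

end

section \<open>Classification\<close>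

text \<open>Here \<open>s\<close> stands for an auxiliary choice attached to \<open>x\<close>, later
  a section. Taking \<open>x = y\<close> in \<open>iff\<close> shows that different choices give
  \<open>Q\<close>-related values, so the class is well defined. That \<open>Q\<close> is an
  equivalence is inherited from \<open>R\<close> through \<open>iff\<close> and \<open>surj\<close>,
  which saves a direct verification for \<open>cohomologous\<close>.\<close>

lemma bij_betw_quotients:
  fixes A :: "'a set" and B :: "'b set" and S :: "'a \<Rightarrow> 's \<Rightarrow> bool"
  assumes R: "equiv A R" and Q: "Q \<subseteq> B \<times> B"
    and ex: "\<And>x. x \<in> A \<Longrightarrow> \<exists>s. S x s"
    and iff: "\<And>x y s t. x \<in> A \<Longrightarrow> y \<in> A \<Longrightarrow> S x s \<Longrightarrow> S y t \<Longrightarrow> (x, y) \<in> R \<longleftrightarrow> (F x s, F y t) \<in> Q"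
    and mem: "\<And>x s. x \<in> A \<Longrightarrow> S x s \<Longrightarrow> F x s \<in> B"
    and surj: "\<And>b. b \<in> B \<Longrightarrow> \<exists>x\<in>A. \<exists>s. S x s \<and> F x s = b"
  shows "\<exists>\<Phi>. bij_betw \<Phi> (A // R) (B // Q) \<and> (\<forall>x\<in>A. \<forall>s. S x s \<longrightarrow> \<Phi> (R `` {x}) = Q `` {F x s})"
proof -
  have R': "R \<subseteq> A \<times> A" "\<And>x. x \<in> A \<Longrightarrow> (x, x) \<in> R" "sym R" "trans R"
    using R unfolding equiv_def refl_on_def by blast+
  have equivQ: "equiv B Q"
  proof (rule equivI)
    show "Q \<subseteq> B \<times> B" by fact
    show "refl_on B Q"
    proof (rule refl_onI)
      fix b assume "b \<in> B"
      then obtain x s where *: "x \<in> A" "S x s" "F x s = b" using surj[of b] by blast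
      show "(b, b) \<in> Q" using iff[OF *(1,1,2,2)] R'(2)[OF *(1)] *(3) by simp
    qed
    show "sym Q"
    proof (rule symI)
      fix b c assume bc: "(b, c) \<in> Q"
      then have "b \<in> B" "c \<in> B" using Q by auto
      then obtain x s y t where *: "x \<in> A" "S x s" "F x s = b" "y \<in> A" "S y t" "F y t = c"
        using surj[of b] surj[of c] by blast
      have "(x, y) \<in> R" using iff[OF *(1,4,2,5)] bc *(3,6) by simp
      then have "(y, x) \<in> R" by (rule symD[OF R'(3)])
      then show "(c, b) \<in> Q" using iff[OF *(4,1,5,2)] *(3,6) by simp
    qed
    show "trans Q"
    proof (rule transI)
      fix b c d assume bc: "(b, c) \<in> Q" and cd: "(c, d) \<in> Q"
      then have "b \<in> B" "c \<in> B" "d \<in> B" using Q by auto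
      then obtain x s y t z r where *: "x \<in> A" "S x s" "F x s = b" "y \<in> A" "S y t" "F y t = c"
        "z \<in> A" "S z r" "F z r = d"
        using surj[of b] surj[of c] surj[of d] by blast
      have "(x, y) \<in> R" using iff[OF *(1,4,2,5)] bc *(3,6) by simp
      moreover have "(y, z) \<in> R" using iff[OF *(4,7,5,8)] cd *(6,9) by simp
      ultimately have "(x, z) \<in> R" by (rule transD[OF R'(4)])
      then show "(b, d) \<in> Q" using iff[OF *(1,7,2,8)] *(3,9) by simp
    qed
  qed
  define r :: "'a set \<Rightarrow> 'a" where "r = (\<lambda>C. SOME x. x \<in> C)"
  define t :: "'a \<Rightarrow> 's" where "t = (\<lambda>x. SOME s. S x s)"
  define \<Phi> where "\<Phi> = (\<lambda>C. Q `` {F (r C) (t (r C))})"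
  have \<Phi>: "\<Phi> (R `` {x}) = Q `` {F x s}" if x: "x \<in> A" "S x s" for x s
  proof -
    define z where "z = r (R `` {x})"
    have "z \<in> R `` {x}"
      unfolding z_def r_def by (rule someI[of _ x]) (simp add: R'(2)[OF x(1)])
    then have z: "(x, z) \<in> R" "z \<in> A" using R'(1) by auto
    have "S z (t z)" unfolding t_def using ex[OF z(2)] by (rule someI_ex)
    then have "(F x s, F z (t z)) \<in> Q" using iff[OF x(1) z(2) x(2)] z(1) by simp
    then show ?thesis
      unfolding \<Phi>_def z_def[symmetric] by (rule equiv_class_eq[OF equivQ, symmetric])
  qed
  have "bij_betw \<Phi> (A // R) (B // Q)"
  proof (rule bij_betwI')
    fix C D assume "C \<in> A // R" "D \<in> A // R"
    then obtain x y where x: "C = R `` {x}" "x \<in> A" and y: "D = R `` {y}" "y \<in> A"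
      by (auto elim!: quotientE)
    obtain s t where st: "S x s" "S y t" using ex x y by blast
    have "\<Phi> C = \<Phi> D \<longleftrightarrow> (F x s, F y t) \<in> Q"
      using \<Phi>[OF x(2) st(1)] \<Phi>[OF y(2) st(2)] x y
        eq_equiv_class_iff[OF equivQ mem[OF x(2) st(1)] mem[OF y(2) st(2)]] by simp
    also have "\<dots> \<longleftrightarrow> C = D"
      using iff[OF x(2) y(2) st] x y eq_equiv_class_iff[OF R x(2) y(2)] by simp
    finally show "\<Phi> C = \<Phi> D \<longleftrightarrow> C = D" .
  next
    fix C assume "C \<in> A // R"
    then obtain x where x: "C = R `` {x}" "x \<in> A" by (auto elim!: quotientE)
    obtain s where s: "S x s" using ex x by blast
    show "\<Phi> C \<in> B // Q"
      unfolding x(1) \<Phi>[OF x(2) s] by (rule quotientI[OF mem[OF x(2) s]])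
  next
    fix D assume "D \<in> B // Q"
    then obtain b where b: "D = Q `` {b}" "b \<in> B" by (auto elim!: quotientE)
    then obtain x s where x: "x \<in> A" "S x s" "F x s = b" using surj by blast
    have "D = \<Phi> (R `` {x})" using \<Phi>[OF x(1,2)] b(1) x(3) by simp
    then show "\<exists>C\<in>A // R. D = \<Phi> C" using quotientI[OF x(1)] by blast
  qed
  then show ?thesis
    by (intro exI[of _ \<Phi>] conjI ballI allI impI \<Phi>)
qed

text \<open>Transport of structure along an injection \<open>h\<close>, used to place the product
  extension inside the given type of total spaces. Taking the image of zero as zero secures the zero
  hypothesis of the transport lemmas.\<close>

definition map_extension ::
  "('e \<Rightarrow> 'f) \<Rightarrow> ('k, 'g, 'v, 'e) extension \<Rightarrow> ('k, 'g, 'v, 'f) extension" where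
  "map_extension h E = (let L = total E; k = inv_into (carrier L) h in
     \<lparr>total = \<lparr>carrier = h ` carrier L, monoid.mult = undefined, one = undefined,
        zero = h \<zero>\<^bsub>L\<^esub>, add = (\<lambda>x y. h (k x \<oplus>\<^bsub>L\<^esub> k y)), module.smult = (\<lambda>c x. h (c \<odot>\<^bsub>L\<^esub> k x)),
        bracket1 = (\<lambda>x y z. h (bracket1 L (k x) (k y) (k z))),
        bracket2 = (\<lambda>x y z. h (bracket2 L (k x) (k y) (k z))),
        twist = (\<lambda>x. h (twist L (k x)))\<rparr>,
      incl = h \<circ> incl E, proj = proj E \<circ> k\<rparr>)"

lemma ext_iso_map_extension:
  assumes "inj_on h (carrier (total E))"
  shows "ext_iso V E (map_extension h E) h" "h \<zero>\<^bsub>total E\<^esub> = \<zero>\<^bsub>total (map_extension h E)\<^esub>"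
  using assms
  by (simp_all add: ext_iso_def chlts_iso_def chlts_hom_def vs_hom_def map_extension_def Let_def
      inj_on_imp_bij_betw)

context chlts_rep
begin

text \<open>The target is an additive group whatever \<open>B1\<close> and \<open>B2\<close> are, so
  this is available before any bracket axiom is known there, and the transport lemmas become
  applicable.\<close>

lemma ext_iso_zero:
  assumes "abelian_extension G V E" "ext_iso V E (prod_extension sg sv \<alpha> \<beta> B1 B2) f"
  shows "f \<zero>\<^bsub>total E\<^esub> = \<zero>\<^bsub>total (prod_extension sg sv \<alpha> \<beta> B1 B2)\<^esub>"
  by (rule vs_hom_zero[OF ext_isoD(2)[OF assms(2)]
        compatible_hom_lts_abelian_group[OF abelian_extensionD(1)[OF assms(1)]]]) simp

lemma extension_normal_form:
  assumes E: "E \<in> extensions_inducing G V \<theta>1 \<theta>2" and \<sigma>: "is_hom_section G E \<sigma>"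
  shows "\<exists>m1 m2 f. ext_iso V E (prod_ext m1 m2) f \<and>
    prod_ext m1 m2 \<in> extensions_inducing G V \<theta>1 \<theta>2 \<and>
    section_cocycle G E \<sigma> = [cochain2 m1, cochain2 m2]"
proof -
  obtain B1 B2 f where f: "ext_iso V E (prod_extension sg sv \<alpha> \<beta> B1 B2) f"
    and f\<sigma>: "\<And>a. f (\<sigma> a) = (a, 0)"
    using ext_iso_prod_extension[OF E \<sigma>] by blast
  have ab: "abelian_extension G V E" using E by (simp add: extensions_inducing_def)
  note z = ext_iso_zero[OF ab f]
  note P = extensions_inducing_transport(1)[OF E f z]
  obtain m1 m2 where m: "prod_extension sg sv \<alpha> \<beta> B1 B2 = prod_ext m1 m2"
    using prod_extension_eq_prod_ext[OF P] by blast
  \<comment> \<open>The section becomes the zero section of the product, whose cocycle is the pair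
    of cochains in the brackets.\<close>
  have "section_cocycle G E \<sigma> = section_cocycle G (prod_ext m1 m2) (f \<circ> \<sigma>)"
    using section_cocycle_transport[OF E f z] \<sigma> unfolding m is_hom_section_def by simp
  also have "f \<circ> \<sigma> = (\<lambda>a. (a, 0))" using f\<sigma> by auto
  finally show ?thesis
    using f P section_cocycle_prod_ext unfolding m by metis
qed

lemma section_cocycle_mem:
  assumes "E \<in> extensions_inducing G V \<theta>1 \<theta>2" "is_hom_section G E \<sigma>"
  shows "section_cocycle G E \<sigma> \<in> cocycles_c sg b1 b2 \<alpha> sv \<beta> \<theta>1 \<theta>2 2"
  using extension_normal_form[OF assms]
  by (auto simp: prod_ext_mem_iff mem_cocycles_c_iff[OF vector_spaces(2)])

lemma equivalent_ext_iff_cohomologous: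
  assumes E1: "E1 \<in> extensions_inducing G V \<theta>1 \<theta>2" "is_hom_section G E1 \<sigma>1"
    and E2: "E2 \<in> extensions_inducing G V \<theta>1 \<theta>2" "is_hom_section G E2 \<sigma>2"
  shows "equivalent_ext E1 V E2 \<longleftrightarrow>
    (section_cocycle G E1 \<sigma>1, section_cocycle G E2 \<sigma>2) \<in> cohomologous sg b1 b2 \<alpha> sv \<beta> \<theta>1 \<theta>2 2"
proof -
  obtain m1 m2 f where f: "ext_iso V E1 (prod_ext m1 m2) f"
    and P1: "prod_ext m1 m2 \<in> extensions_inducing G V \<theta>1 \<theta>2"
    and m: "section_cocycle G E1 \<sigma>1 = [cochain2 m1, cochain2 m2]"
    using extension_normal_form[OF E1] by blast
  obtain n1 n2 g where g: "ext_iso V E2 (prod_ext n1 n2) g"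
    and P2: "prod_ext n1 n2 \<in> extensions_inducing G V \<theta>1 \<theta>2"
    and n: "section_cocycle G E2 \<sigma>2 = [cochain2 n1, cochain2 n2]"
    using extension_normal_form[OF E2] by blast
  have ab: "abelian_extension G V E1" "abelian_extension G V E2"
    using E1 E2 by (simp_all add: extensions_inducing_def)
  \<comment> \<open>Conjugation by the two normal forms, which come from independently chosen
    sections.\<close>
  have "equivalent_ext E1 V E2 \<longleftrightarrow> (\<exists>\<zeta>. ext_iso V (prod_ext m1 m2) (prod_ext n1 n2) \<zeta>)"
    unfolding equivalent_ext_iff
    using ext_iso_comp f g ext_iso_inv[OF ab(1) f] ext_iso_inv[OF ab(2) g] by meson
  then show ?thesis
    using P1 P2 unfolding ext_iso_prod_ext_iff m n mem_cohomologous_iff[OF vector_spaces(2)]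
      prod_ext_mem_iff by simp
qed

lemma equiv_equivalence_rel:
  "equiv (extensions_inducing G V \<theta>1 \<theta>2) (equivalence_rel G V \<theta>1 \<theta>2)"
proof (rule equivI)
  show "equivalence_rel G V \<theta>1 \<theta>2 \<subseteq>
      extensions_inducing G V \<theta>1 \<theta>2 \<times> extensions_inducing G V \<theta>1 \<theta>2"
    by (auto simp: equivalence_rel_def)
  show "refl_on (extensions_inducing G V \<theta>1 \<theta>2) (equivalence_rel G V \<theta>1 \<theta>2)"
    by (auto simp: equivalence_rel_def refl_on_def equivalent_ext_iff intro: ext_iso_id)
  show "sym (equivalence_rel G V \<theta>1 \<theta>2)"
    unfolding sym_def equivalence_rel_def equivalent_ext_iff extensions_inducing_def
    using ext_iso_inv by blast
  show "trans (equivalence_rel G V \<theta>1 \<theta>2)"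
    unfolding trans_def equivalence_rel_def equivalent_ext_iff
    using ext_iso_comp by blast
qed

lemma exists_extension_of_cocycle:
  fixes h :: "'g \<times> 'v \<Rightarrow> 'e"
  assumes mixed: "mixed_rep_identity b1 b2 \<alpha> \<beta> \<theta>1 \<theta>2" and "inj h"
    and fs: "fs \<in> cocycles_c sg b1 b2 \<alpha> sv \<beta> \<theta>1 \<theta>2 2"
  shows "\<exists>E\<in>extensions_inducing G V \<theta>1 \<theta>2. \<exists>\<sigma> :: 'g \<Rightarrow> 'e.
    is_hom_section G E \<sigma> \<and> section_cocycle G E \<sigma> = fs"
proof -
  obtain m1 m2 where m: "fs = [cochain2 m1, cochain2 m2]"
    using cocycles_cE[OF fs] .
  have P: "prod_ext m1 m2 \<in> extensions_inducing G V \<theta>1 \<theta>2"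
    using fs mixed unfolding m mem_cocycles_c_iff[OF vector_spaces(2)] prod_ext_mem_iff by simp
  have inj: "inj_on h (carrier (total (prod_ext m1 m2)))" using \<open>inj h\<close> by simp
  note iso = ext_iso_map_extension(1)[OF inj, of V] ext_iso_map_extension(2)[OF inj]
  have sec: "is_hom_section G (prod_ext m1 m2) (\<lambda>a. (a, 0))"
    by (rule is_hom_section_Pair_0)
  show ?thesis
    using extensions_inducing_transport[OF P iso] sec section_cocycle_transport[OF P iso]
      section_cocycle_prod_ext unfolding m is_hom_section_def by metis
qed

text \<open>Under the mixed identity it yields the semidirect product, the witness that extensions
  exist.\<close>

lemma zero_cocycle: "replicate 2 (cochain2 (\<lambda>_ _ _. 0)) \<in> cocycles_c sg b1 b2 \<alpha> sv \<beta> \<theta>1 \<theta>2 2"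
  using vector_spaces linear_zero_eq[OF linear_beta]
  by (simp add: numeral_2_eq_2 mem_cocycles_c_iff[OF vector_spaces(2), unfolded numeral_2_eq_2]
      cocycle_pair_def lts_cochain_def type_trilinear_def linear_iff' scale_zero
      cocycle_defect_def theta_zero rep_D_def)

end

theorem theorem5p3:
  fixes sg :: "'k::field_char_0 \<Rightarrow> 'g::ab_group_add \<Rightarrow> 'g"
    and b1 b2 :: "'g \<Rightarrow> 'g \<Rightarrow> 'g \<Rightarrow> 'g" and \<alpha> :: "'g \<Rightarrow> 'g"
    and sv :: "'k \<Rightarrow> 'v::ab_group_add \<Rightarrow> 'v" and \<beta> :: "'v \<Rightarrow> 'v"
    and \<theta>1 \<theta>2 :: "'g \<Rightarrow> 'g \<Rightarrow> 'v \<Rightarrow> 'v"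
    and G :: "('k, 'g) chlts" and V :: "('k, 'v) chlts"
    and Ext :: "('k, 'g, 'v, 'e) extension set"
  defines "G \<equiv> chlts_of sg b1 b2 \<alpha>" and "V \<equiv> trivial_chlts sv \<beta>"
    and "Ext \<equiv> extensions_inducing G V \<theta>1 \<theta>2"
  assumes "compatible_hom_lts G"
    and "hom_vector_space sv \<beta>"
    and "compatible_rep sg b1 b2 \<alpha> sv \<beta> \<theta>1 \<theta>2"
    and "\<exists>h :: 'g \<times> 'v \<Rightarrow> 'e. inj h"
  shows "(Ext \<noteq> {} \<longleftrightarrow> mixed_rep_identity b1 b2 \<alpha> \<beta> \<theta>1 \<theta>2) \<and>
    (Ext \<noteq> {} \<longrightarrow>
      (\<exists>\<Phi>. bij_betw \<Phi> (Ext // equivalence_rel G V \<theta>1 \<theta>2) (cohomology_c sg b1 b2 \<alpha> sv \<beta> \<theta>1 \<theta>2 2) \<and>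
           (\<forall>E\<in>Ext. \<forall>\<sigma>. is_hom_section G E \<sigma> \<longrightarrow>
              \<Phi> (equivalence_rel G V \<theta>1 \<theta>2 `` {E}) =
              cohomologous sg b1 b2 \<alpha> sv \<beta> \<theta>1 \<theta>2 2 `` {section_cocycle G E \<sigma>})))"
proof -
  interpret chlts_rep sg b1 b2 \<alpha> sv \<beta> \<theta>1 \<theta>2
    by standard (use assms in auto)
  obtain h :: "'g \<times> 'v \<Rightarrow> 'e" where h: "inj h" using assms by blast
  have nonempty: "Ext \<noteq> {} \<longleftrightarrow> mixed_rep_identity b1 b2 \<alpha> \<beta> \<theta>1 \<theta>2"
  proof
    assume "Ext \<noteq> {}"
    then obtain E \<sigma> where "E \<in> Ext" "is_hom_section G E \<sigma>"
      by (auto simp: Ext_def extensions_inducing_def)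
    then show "mixed_rep_identity b1 b2 \<alpha> \<beta> \<theta>1 \<theta>2"
      using extension_normal_form unfolding Ext_def G_def V_def prod_ext_mem_iff by blast
  next
    assume "mixed_rep_identity b1 b2 \<alpha> \<beta> \<theta>1 \<theta>2"
    from exists_extension_of_cocycle[OF this h zero_cocycle] show "Ext \<noteq> {}"
      unfolding Ext_def G_def V_def by blast
  qed
  moreover have "\<exists>\<Phi>. bij_betw \<Phi> (Ext // equivalence_rel G V \<theta>1 \<theta>2)
        (cohomology_c sg b1 b2 \<alpha> sv \<beta> \<theta>1 \<theta>2 2) \<and>
      (\<forall>E\<in>Ext. \<forall>\<sigma>. is_hom_section G E \<sigma> \<longrightarrow>
        \<Phi> (equivalence_rel G V \<theta>1 \<theta>2 `` {E}) =
        cohomologous sg b1 b2 \<alpha> sv \<beta> \<theta>1 \<theta>2 2 `` {section_cocycle G E \<sigma>})"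
    if "Ext \<noteq> {}"
    unfolding cohomology_c_def
  \<comment> \<open>The auxiliary choice is a section commuting with the twists, and
    \<open>F\<close> is \<open>section_cocycle G\<close>.\<close>
  proof (rule bij_betw_quotients)
    show "equiv Ext (equivalence_rel G V \<theta>1 \<theta>2)"
      unfolding Ext_def G_def V_def by (rule equiv_equivalence_rel)
    show "\<exists>\<sigma>. is_hom_section G E \<sigma>" if "E \<in> Ext" for E
      using that by (simp add: Ext_def extensions_inducing_def)
    show "(E1, E2) \<in> equivalence_rel G V \<theta>1 \<theta>2 \<longleftrightarrow>
        (section_cocycle G E1 \<sigma>1, section_cocycle G E2 \<sigma>2) \<in> cohomologous sg b1 b2 \<alpha> sv \<beta> \<theta>1 \<theta>2 2"
      if "E1 \<in> Ext" "E2 \<in> Ext" "is_hom_section G E1 \<sigma>1" "is_hom_section G E2 \<sigma>2" for E1 E2 \<sigma>1 \<sigma>2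
      using equivalent_ext_iff_cohomologous that
      unfolding Ext_def G_def V_def equivalence_rel_def by simp
    show "section_cocycle G E \<sigma> \<in> cocycles_c sg b1 b2 \<alpha> sv \<beta> \<theta>1 \<theta>2 2"
      if "E \<in> Ext" "is_hom_section G E \<sigma>" for E \<sigma>
      using section_cocycle_mem that unfolding Ext_def G_def V_def by blast
    show "\<exists>E\<in>Ext. \<exists>\<sigma>. is_hom_section G E \<sigma> \<and> section_cocycle G E \<sigma> = fs"
      if "fs \<in> cocycles_c sg b1 b2 \<alpha> sv \<beta> \<theta>1 \<theta>2 2" for fs
      \<comment> \<open>Existence of a single extension supplies the mixed identity, under which
        every cocycle is realised.\<close>
      using exists_extension_of_cocycle[OF _ h that] nonempty \<open>Ext \<noteq> {}\<close>
      unfolding Ext_def G_def V_def by blast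
  qed (auto simp: cohomologous_def)
  ultimately show ?thesis by blast
qed

end
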